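(* Let $A=\mathbb{Q}\cdot 1_A\oplus\mathbb{Q}\cdot a\oplus\mathbb{Q}\cdot a^2$ with $a^3=0$, let $\underline{a}=(1_A,a,a^2)$, and let $\Lambda_a=\mathbb{Z}[a]=\mathbb{Z}1_A+\mathbb{Z}a+\mathbb{Z}a^2\subset A$. (a) Each order $\Lambda\supset\Lambda_a$ has a unique $\mathbb{Z}$-basis of the shape $$\underline{a}\begin{pmatrix}1&0&0\\0&\alpha_{22}&0\\0&\alpha_{32}&\alpha_{33}\end{pmatrix}\quad\text{with}\quad \alpha_{22}=\frac{1}{n_2},\ \alpha_{33}=\frac{1}{n_2^2n_3},\ \alpha_{32}=\frac{n_4}{n_2^3n_3}$$ for some $n_2,n_3\in\mathbb{N}$, $n_4\in[0,n_2)\cap\mathbb{Z}$. Then $\Delta(\Lambda)=n_3$. (b) Consider an order $\Lambda$ as in (a) and a decomposition $\Delta(\Lambda)=n_3=n_1d_1$ with $n_1,d_1\in\mathbb{N}$ and $\gcd(n_1,d_1)=1$. Let $[L]_\varepsilon$ be the unique $\varepsilon$-class of full lattices with order $\Lambda$ and with $\Delta([L]_\varepsilon)=\frac{n_1}{d_1}$. The normal form representative $L$ of this $\varepsilon$-class has the $\mathbb{Z}$-basis $$\underline{a}\begin{pmatrix}1&0&0\\0&\gamma_{22}&0\\0&\gamma_{32}&\gamma_{33}\end{pmatrix}\quad\text{with}\quad \gamma_{22}=\frac{\alpha_{22}}{d_1}=\frac{1}{d_1n_2},\ \gamma_{33}=\alpha_{33}=\frac{1}{n_2^2n_3},\ \gamma_{32}=\frac{\alpha_{32}}{d_1}=\frac{n_4}{d_1n_2^3n_3}.$$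 (c) Call the $\mathbb{Z}$-basis in (b) $(b_0,b_1,b_2)$. The nilpotent integer $3\times3$ matrix $M$ with a single Jordan block which is determined by $a\cdot(b_2,b_1,b_0)=(b_2,b_1,b_0)\cdot M$ is $$M=\begin{pmatrix}0&n_1n_2&-n_4\\0&0&d_1n_2\\0&0&0\end{pmatrix}.$$ Here $n_2\in\mathbb{N}$, $n_3=n_1d_1\in\mathbb{N}$ and $n_4\in[0,n_2)\cap\mathbb{Z}$ determine the associated order $\Lambda$, with $\Delta(\Lambda)=n_3$, and the decomposition $n_3=n_1d_1$ with $n_1,d_1\in\mathbb{N}$, $\gcd(n_1,d_1)=1$ fixes the associated $\varepsilon$-class of full lattices with order $\Lambda$. (d) The set $$\Bigl\{\begin{pmatrix}0&m_1&-m_3\\0&0&m_2\\0&0&0\end{pmatrix}\ :\ m_1,m_2\in\mathbb{N},\ m_3\in[0,\gcd(m_1,m_2))\cap\mathbb{Z}\Bigr\}$$ is a set of representatives of the $GL_3(\mathbb{Z})$-conjugacy classes of nilpotent integer $3\times 3$ matrices with a $3\times3$ Jordan block, with exactly one representative for each conjugacy class. From such a representative the order $\mathcal{O}(L)$ of the corresponding $\varepsilon$-class $[L]_\varepsilon$ can be read off: it is as in (a) with $n_2=\gcd(m_1,m_2)$, $n_3=\frac{m_1m_2}{n_2^2}$ and $n_4=m_3$. Furthermore $n_1$ and $d_1$ in (b) are $n_1=\frac{m_1}{n_2}$ and $d_1=\frac{m_2}{n_2}$.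
   Context: $\mathbb{N}=\{1,2,\dots\}$. For a tuple $\underline{v}=(v_1,\dots,v_n)$ of vectors and a matrix $M=(m_{ij})$, $\underline{v}\cdot M$ is the tuple whose $j$-th entry is $\sum_i m_{ij}v_i$. A full lattice in $A$ is a finitely generated $\mathbb{Z}$-submodule generating $A$ over $\mathbb{Q}$; $\mathcal{L}(A)$ is the set of full lattices. An order is a full lattice $\Lambda$ with $1_A\in\Lambda$, $\Lambda\Lambda\subset\Lambda$; $\mathcal{O}(L)=\{x\in A: xL\subset L\}$ is the order of $L$. Two full lattices are $\varepsilon$-equivalent if $L_2=uL_1$ for a unit $u\in A^{unit}$ (the group of units of $A$); $[L]_\varepsilon$ is the class of $L$. Each $L\in\mathcal{L}(A)$ has a unique $\mathbb{Z}$-basis $\underline{a}\begin{pmatrix}\beta_{11}&0&0\\\beta_{21}&\beta_{22}&0\\\beta_{31}&\beta_{32}&\beta_{33}\end{pmatrix}$ with $\beta_{11},\beta_{22},\beta_{33}\in\mathbb{Q}_{>0}$, $\beta_{ij}\in(-\frac12\beta_{ii},\frac12\beta_{ii}]\cap\mathbb{Q}$ for $i>j$. Define $\Delta(L):=\frac{\beta_{22}^2}{\beta_{11}\beta_{33}}\in\mathbb{Q}_{>0}$. It depends only on $[L]_\varepsilon$, so $\Delta([L]_\varepsilon)$ is well defined; $\Delta(\Lambda)\in\mathbb{N}$ for an order $\Lambda$; and for each order $\Lambda$ and each decomposition $\Delta(\Lambda)=n_1d_1$ with $n_1,d_1\in\mathbb{N}$ coprime there is exactly one $\varepsilon$-class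 $[L]_\varepsilon$ with $\mathcal{O}(L)=\Lambda$ and $\Delta([L]_\varepsilon)=n_1/d_1$. For $q_1,q_2\in\mathbb{Q}$ not both $0$, $\gcd_{\mathbb{Q}}(q_1,q_2)\in\mathbb{Q}_{>0}$ is defined by $\mathbb{Z}q_1+\mathbb{Z}q_2=\mathbb{Z}\gcd_{\mathbb{Q}}(q_1,q_2)$. Normal form representative: each $\varepsilon$-class contains a unique full lattice with a $\mathbb{Z}$-basis $\underline{a}\begin{pmatrix}1&0&0\\0&\gamma_{22}&0\\0&\gamma_{32}&\gamma_{33}\end{pmatrix}$ with $\gamma_{22},\gamma_{33}\in\mathbb{Q}_{>0}$ and $\gamma_{32}\in[0,\gcd_{\mathbb{Q}}(\gamma_{22}^2,\gamma_{33}))\cap\mathbb{Q}$, and this basis is unique. Correspondence: an $\varepsilon$-class $[L]_\varepsilon$ with $\mathcal{O}(L)\supset\Lambda_a$ corresponds to the $GL_3(\mathbb{Z})$-conjugacy class of the matrices $M\in M_{3\times3}(\mathbb{Z})$ with $a\cdot\mathcal{B}=\mathcal{B}\cdot M$, where $\mathcal{B}$ runs through the $\mathbb{Z}$-bases of $L$. This is a bijection onto the set of conjugacy classes of nilpotent integer $3\times3$ matrices with a single Jordan block. *)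

theory Defs
  imports "Jordan_Normal_Form.Jordan_Normal_Form"
begin

text \<open>The algebra \<open>A = \<rat>1 \<oplus> \<rat>a \<oplus> \<rat>a\<^sup>2\<close> with \<open>a\<^sup>3 = 0\<close>; \<open>Elt x y z\<close> is the element \<open>x + y a + z a\<^sup>2\<close>.\<close>

datatype nilalg = Elt (c0: rat) (c1: rat) (c2: rat)

instantiation nilalg :: comm_ring_1
begin

definition "0 = Elt 0 0 0"
definition "1 = Elt 1 0 0"
definition "x + y = Elt (c0 x + c0 y) (c1 x + c1 y) (c2 x + c2 y)"
definition "- x = Elt (- c0 x) (- c1 x) (- c2 x)"
definition "x - y = Elt (c0 x - c0 y) (c1 x - c1 y) (c2 x - c2 y)"
definition "x * y = Elt (c0 x * c0 y) (c0 x * c1 y + c1 x * c0 y)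
  (c0 x * c2 y + c1 x * c1 y + c2 x * c0 y)"

instance
  by standard
    (auto simp: zero_nilalg_def one_nilalg_def plus_nilalg_def uminus_nilalg_def
      minus_nilalg_def times_nilalg_def algebra_simps)

end

definition scaleQ :: "rat \<Rightarrow> nilalg \<Rightarrow> nilalg"  (infixr "*\<^sub>Q" 75) where
  "q *\<^sub>Q x = Elt (q * c0 x) (q * c1 x) (q * c2 x)"

definition gen_a :: nilalg where
  "gen_a = Elt 0 1 0"

lemma gen_a_power2: "gen_a ^ 2 = Elt 0 0 1"
  by (simp add: gen_a_def power2_eq_square times_nilalg_def)

lemma gen_a_power3: "gen_a ^ 3 = 0"
  by (simp add: gen_a_def power3_eq_cube times_nilalg_def zero_nilalg_def)

lemma Elt_conv_gen_a: "Elt x y z = x *\<^sub>Q 1 + y *\<^sub>Q gen_a + z *\<^sub>Q gen_a ^ 2"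
  unfolding gen_a_power2 by (simp add: gen_a_def scaleQ_def one_nilalg_def plus_nilalg_def)

text \<open>Both locales below are those of the HOL distribution; the qualifier avoids the
  homonymous carrier-based locales of HOL-Algebra.\<close>

interpretation Q: Vector_Spaces.vector_space scaleQ
  by unfold_locales (auto simp: scaleQ_def plus_nilalg_def algebra_simps)

interpretation Z: Modules.module "\<lambda>(k::int) (x::nilalg). of_int k * x"
  by unfold_locales (auto simp: algebra_simps)

text \<open>The tuple \<open>v \<cdot> M\<close>; its \<open>j\<close>-th entry is \<open>\<Sum>i. m\<^sub>i\<^sub>j v\<^sub>i\<close>. Matrix indices start at 0.\<close>

definition tuple_mult :: "nilalg list \<Rightarrow> rat mat \<Rightarrow> nilalg list"  (infixl "\<cdot>\<^sub>t" 70) where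
  "v \<cdot>\<^sub>t M = map (\<lambda>j. \<Sum>i<dim_row M. (M $$ (i,j)) *\<^sub>Q (v ! i)) [0..<dim_col M]"

definition avec :: "nilalg list" where
  "avec = [1, gen_a, gen_a ^ 2]"

definition is_Zbasis :: "nilalg list \<Rightarrow> nilalg set \<Rightarrow> bool" where
  "is_Zbasis b L \<longleftrightarrow> distinct b \<and> Z.independent (set b) \<and> Z.span (set b) = L"

definition full_lattice :: "nilalg set \<Rightarrow> bool" where
  "full_lattice L \<longleftrightarrow> (\<exists>S. finite S \<and> Z.span S = L) \<and> Q.span L = UNIV"

definition is_order :: "nilalg set \<Rightarrow> bool" where
  "is_order \<Lambda> \<longleftrightarrow> full_lattice \<Lambda> \<and> 1 \<in> \<Lambda> \<and> (\<forall>x\<in>\<Lambda>. \<forall>y\<in>\<Lambda>. x * y \<in> \<Lambda>)"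

text \<open>The order \<open>\<O>(L)\<close> of a full lattice.\<close>

definition order_of :: "nilalg set \<Rightarrow> nilalg set" where
  "order_of L = {x. (\<lambda>y. x * y) ` L \<subseteq> L}"

definition Lambda_a :: "nilalg set" where
  "Lambda_a = Z.span {1, gen_a, gen_a ^ 2}"

definition eps_rel :: "(nilalg set \<times> nilalg set) set" where
  "eps_rel = {(L1, L2). full_lattice L1 \<and> full_lattice L2 \<and>
     (\<exists>u. u dvd 1 \<and> L2 = (\<lambda>x. u * x) ` L1)}"

definition eps_classes :: "nilalg set set set" where
  "eps_classes = {L. full_lattice L} // eps_rel"

definition lower_reduced :: "rat mat \<Rightarrow> bool" where
  "lower_reduced \<beta> \<longleftrightarrow> \<beta> \<in> carrier_mat 3 3 \<and>
     (\<forall>i<3. \<forall>j<3. i < j \<longrightarrow> \<beta> $$ (i,j) = 0) \<and>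
     (\<forall>i<3. \<beta> $$ (i,i) > 0) \<and>
     (\<forall>i<3. \<forall>j<i. - (\<beta> $$ (i,i)) / 2 < \<beta> $$ (i,j) \<and> \<beta> $$ (i,j) \<le> \<beta> $$ (i,i) / 2)"

text \<open>Every full lattice \<open>L\<close> has exactly one \<open>\<int>\<close>-basis of the form \<open>avec \<cdot>\<^sub>t \<beta>\<close> with
  \<open>lower_reduced \<beta>\<close>; \<open>\<Delta>(L)\<close> is read off from this \<open>\<beta>\<close>.\<close>

definition Delta :: "nilalg set \<Rightarrow> rat" where
  "Delta L = (let \<beta> = (THE \<beta>. lower_reduced \<beta> \<and> is_Zbasis (avec \<cdot>\<^sub>t \<beta>) L)
     in (\<beta> $$ (1,1))\<^sup>2 / (\<beta> $$ (0,0) * \<beta> $$ (2,2)))"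

text \<open>\<open>Delta\<close> is constant on \<open>\<epsilon>\<close>-classes.\<close>

definition Delta_class :: "nilalg set set \<Rightarrow> rat" where
  "Delta_class C = the_elem (Delta ` C)"

text \<open>The positive generator of \<open>\<int>q\<^sub>1 + \<int>q\<^sub>2\<close>. (The library's \<^const>\<open>gcd\<close> is not meant
  here: over a field all nonzero elements are associated.)\<close>

definition gcdQ :: "rat \<Rightarrow> rat \<Rightarrow> rat" where
  "gcdQ q1 q2 = (THE g. g > 0 \<and>
     {of_int x * q1 + of_int y * q2 | x y. True} = range (\<lambda>z. of_int z * g))"

definition shape :: "rat \<Rightarrow> rat \<Rightarrow> rat \<Rightarrow> rat mat" where
  "shape x22 x32 x33 = mat_of_rows_list 3
     [[1, 0,   0],
      [0, x22, 0],
      [0, x32, x33]]"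

definition normal_form :: "rat mat \<Rightarrow> bool" where
  "normal_form \<gamma> \<longleftrightarrow> (\<exists>g22 g32 g33. \<gamma> = shape g22 g32 g33 \<and>
     g22 > 0 \<and> g33 > 0 \<and> 0 \<le> g32 \<and> g32 < gcdQ (g22\<^sup>2) g33)"

definition normal_form_rep :: "nilalg set set \<Rightarrow> nilalg set" where
  "normal_form_rep C = (THE L. L \<in> C \<and> (\<exists>\<gamma>. normal_form \<gamma> \<and> is_Zbasis (avec \<cdot>\<^sub>t \<gamma>) L))"

definition alpha_mat :: "nat \<Rightarrow> nat \<Rightarrow> nat \<Rightarrow> rat mat" where
  "alpha_mat n2 n3 n4 = shape
     (1 / of_nat n2) (of_nat n4 / (of_nat n2 ^ 3 * of_nat n3)) (1 / (of_nat n2 ^ 2 * of_nat n3))"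

definition gamma_mat :: "nat \<Rightarrow> nat \<Rightarrow> nat \<Rightarrow> nat \<Rightarrow> rat mat" where
  "gamma_mat d1 n2 n3 n4 = shape
     (1 / (of_nat d1 * of_nat n2))
     (of_nat n4 / (of_nat d1 * of_nat n2 ^ 3 * of_nat n3))
     (1 / (of_nat n2 ^ 2 * of_nat n3))"

text \<open>Nilpotent integer \<open>3 \<times> 3\<close> matrices with a single Jordan block. Since the eigenvalue is
  rational, the Jordan normal form may be taken over \<open>\<rat>\<close>.\<close>

definition nilp_single_block :: "int mat set" where
  "nilp_single_block = {M \<in> carrier_mat 3 3. (\<exists>k. M ^\<^sub>m k = 0\<^sub>m 3 3) \<and>
     (\<exists>ev. jordan_nf (map_mat rat_of_int M) [(3, ev)])}"

text \<open>For integer matrices, \<^const>\<open>similar_mat\<close> is conjugacy under \<open>GL\<^sub>n(\<int>)\<close>: the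
  transforming matrix and its inverse both have integer entries.\<close>

definition conj_class :: "int mat \<Rightarrow> int mat set" where
  "conj_class M = {N. similar_mat N M}"

definition mult_by_a :: "nilalg list \<Rightarrow> int mat \<Rightarrow> bool" where
  "mult_by_a b M \<longleftrightarrow> M \<in> carrier_mat 3 3 \<and> map (\<lambda>x. gen_a * x) b = b \<cdot>\<^sub>t map_mat rat_of_int M"

text \<open>The matrices corresponding to an \<open>\<epsilon>\<close>-class \<open>C = [L]\<close>. Any representative gives the same
  set, because \<open>u \<B>\<close> is a basis of \<open>u L\<close> with the same matrix as the basis \<open>\<B>\<close> of \<open>L\<close>.\<close>

definition class_matrices :: "nilalg set set \<Rightarrow> int mat set" where
  "class_matrices C = {M. \<exists>L\<in>C. \<exists>b. is_Zbasis b L \<and> mult_by_a b M}"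

definition corresponds :: "nilalg set set \<Rightarrow> int mat \<Rightarrow> bool" where
  "corresponds C M \<longleftrightarrow> C \<in> eps_classes \<and> (\<forall>L\<in>C. Lambda_a \<subseteq> order_of L) \<and>
     class_matrices C = conj_class M"

definition rep_mat :: "nat \<Rightarrow> nat \<Rightarrow> nat \<Rightarrow> int mat" where
  "rep_mat m1 m2 m3 = mat_of_rows_list 3
     [[0, int m1, - int m3],
      [0, 0,      int m2],
      [0, 0,      0]]"

definition rep_mats :: "int mat set" where
  "rep_mats = {rep_mat m1 m2 m3 | m1 m2 m3. m1 > 0 \<and> m2 > 0 \<and> m3 < gcd m1 m2}"

definition class_with :: "nilalg set \<Rightarrow> rat \<Rightarrow> nilalg set set \<Rightarrow> bool" where
  "class_with \<Lambda> q C \<longleftrightarrow> C \<in> eps_classes \<and> (\<forall>L\<in>C. order_of L = \<Lambda>) \<and> Delta_class C = q"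

end

theory Submission
  imports Defs
begin

text \<open>
  Everything is governed by one family of lattices with three parameters. For \<open>m\<^sub>1, m\<^sub>2 > 0\<close> let
  \<open>L(m\<^sub>1, m\<^sub>2, m\<^sub>3)\<close> be the lattice with basis
  \<open>b\<^sub>0 = 1\<close>, \<open>b\<^sub>1 = a/m\<^sub>2 + (m\<^sub>3/(m\<^sub>1 m\<^sub>2\<^sup>2)) a\<^sup>2\<close>, \<open>b\<^sub>2 = a\<^sup>2/(m\<^sub>1 m\<^sub>2)\<close>;
  below it is called \<open>rep_lattice m1 m2 m3\<close>. Multiplication by \<open>a\<close> sends \<open>b\<^sub>2\<close> to \<open>0\<close>,
  \<open>b\<^sub>1\<close> to \<open>m\<^sub>1 b\<^sub>2\<close> and \<open>b\<^sub>0\<close> to \<open>m\<^sub>2 b\<^sub>1 - m\<^sub>3 b\<^sub>2\<close>, so in the basis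
  \<open>(b\<^sub>2, b\<^sub>1, b\<^sub>0)\<close> it is the matrix \<open>rep_mat m1 m2 m3\<close>. Putting \<open>m\<^sub>1 = n\<^sub>1 n\<^sub>2\<close>,
  \<open>m\<^sub>2 = d\<^sub>1 n\<^sub>2\<close> and \<open>m\<^sub>3 = n\<^sub>4\<close> gives the basis \<open>gamma_mat\<close>; the basis \<open>alpha_mat\<close>
  is the case \<open>m\<^sub>1 = n\<^sub>2 n\<^sub>3\<close>, \<open>m\<^sub>2 = n\<^sub>2\<close>. Hence (a)--(c) are statements about the lattices
  \<open>L(m\<^sub>1, m\<^sub>2, m\<^sub>3)\<close>, and (d) translates them into matrices.

  \<^bold>\<open>Existence of the normal form.\<close> A full lattice is discrete, so successive projections to the
  three coordinates have cyclic images, and it has a lower triangular basis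
  (\<open>full_lattice_triangular_basis\<close>). Dividing by the first basis vector, a unit, makes that
  vector \<open>1\<close>; the lattice becomes \<open>\<int> + \<int>(g a + h a\<^sup>2) + \<int> k a\<^sup>2\<close>. If it is stable under \<open>a\<close>,
  then \<open>a\<close> and \<open>g a\<^sup>2\<close> lie in it, which forces \<open>g = 1/m\<^sub>2\<close>, \<open>k = g/m\<^sub>1\<close> and makes \<open>h\<close> an
  integer multiple of \<open>1/(m\<^sub>1 m\<^sub>2\<^sup>2)\<close> (\<open>full_lattice_eps_rep_lattice\<close>).

  \<^bold>\<open>Uniqueness.\<close> A unit carrying one such lattice to another is, up to sign, of the form
  \<open>1 + x g a + \<dots>\<close> with integral \<open>x\<close>; it fixes \<open>g\<close> and \<open>k\<close> and adds \<open>x g\<^sup>2\<close> to \<open>h\<close>, while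
  \<open>h\<close> counts only modulo \<open>k\<close>. Hence the \<open>\<epsilon>\<close>-class determines \<open>g\<close>, \<open>k\<close> and
  \<open>h\<close> modulo \<open>\<int> g\<^sup>2 + \<int> k\<close> and nothing more (\<open>nlat_eps_iff\<close>). In terms of the parameters,
  \<open>m\<^sub>1\<close>, \<open>m\<^sub>2\<close> and the residue of \<open>m\<^sub>3\<close> modulo \<open>gcd m\<^sub>1 m\<^sub>2\<close> are the invariants.

  \<^bold>\<open>Orders and Delta.\<close> An element \<open>i + j (g a + h a\<^sup>2) + l k a\<^sup>2\<close> multiplies the lattice into
  itself iff \<open>j g\<^sup>2\<close> is in \<open>\<int> k\<close>, that is, iff the reduced denominator \<open>d\<close> of \<open>g\<^sup>2/k\<close> divides
  \<open>j\<close>; so passing to the order multiplies \<open>g\<close> and \<open>h\<close> by \<open>d\<close> (\<open>order_of_nlat\<close>). As Delta is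
  \<open>g\<^sup>2/k = m\<^sub>1/m\<^sub>2\<close>, the lattice \<open>L(n\<^sub>1 c, d\<^sub>1 c, m)\<close> with coprime \<open>n\<^sub>1, d\<^sub>1\<close> has Delta
  \<open>n\<^sub>1/d\<^sub>1\<close> and order \<open>L(n\<^sub>1 d\<^sub>1 c, c, m)\<close>, from which the parameters can be read off in both
  directions (\<open>class_with_iff\<close>). An order is its own order, so this also lists the orders.

  \<^bold>\<open>Matrices.\<close> Two bases of one lattice give matrices conjugate over the integers, and every
  integral conjugate arises from another basis of the same lattice. A basis of any lattice with
  matrix \<open>rep_mat m1 m2 m3\<close> is a unit multiple of \<open>(b\<^sub>2, b\<^sub>1, b\<^sub>0)\<close>, because its last vector
  determines the others through multiplication by \<open>a\<close> (\<open>rep_mat_determines_eps_class\<close>). Finally,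
  a rational Jordan basis of a nilpotent integer matrix with one block identifies \<open>\<int>\<^sup>3\<close> with
  a full lattice of \<open>A\<close> on which the matrix acts as \<open>a\<close> (\<open>single_block_lattice\<close>). Conjugacy
  classes of such matrices and \<open>\<epsilon>\<close>-classes are thereby the same thing.
\<close>

section \<open>Integer combinations of a tuple and changes of basis\<close>

lemma nilalg_sel [simp]:
  "c0 0 = 0" "c1 0 = 0" "c2 0 = 0" "c0 1 = 1" "c1 1 = 0" "c2 1 = 0"
  "c0 (x + y) = c0 x + c0 y" "c1 (x + y) = c1 x + c1 y" "c2 (x + y) = c2 x + c2 y"
  "c0 (x - y) = c0 x - c0 y" "c1 (x - y) = c1 x - c1 y" "c2 (x - y) = c2 x - c2 y"
  "c0 (- x) = - c0 x" "c1 (- x) = - c1 x" "c2 (- x) = - c2 x"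
  "c0 (x * y) = c0 x * c0 y"
  "c1 (x * y) = c0 x * c1 y + c1 x * c0 y"
  "c2 (x * y) = c0 x * c2 y + c1 x * c1 y + c2 x * c0 y"
  "c0 (q *\<^sub>Q x) = q * c0 x" "c1 (q *\<^sub>Q x) = q * c1 x" "c2 (q *\<^sub>Q x) = q * c2 x"
  "c0 gen_a = 0" "c1 gen_a = 1" "c2 gen_a = 0"
  by (simp_all add: zero_nilalg_def one_nilalg_def plus_nilalg_def uminus_nilalg_def
      minus_nilalg_def times_nilalg_def scaleQ_def gen_a_def)

lemma nilalg_eq_iff: "x = y \<longleftrightarrow> c0 x = c0 y \<and> c1 x = c1 y \<and> c2 x = c2 y"
  by (cases x; cases y) auto

lemma nilalg_sel_of_int [simp]:
  "c0 (of_int n) = of_int n" "c1 (of_int n) = 0" "c2 (of_int n) = 0"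
proof -
  have "of_nat m = Elt (of_nat m) 0 0" for m
    by (induction m) (simp_all add: nilalg_eq_iff)
  then have "of_int n = Elt (of_int n) 0 0"
    by (cases n) (auto simp: nilalg_eq_iff simp del: of_nat_Suc)
  then show "c0 (of_int n) = of_int n" "c1 (of_int n) = 0" "c2 (of_int n) = 0"
    by simp_all
qed

lemma scaleQ_of_int: "of_int n *\<^sub>Q x = of_int n * x"
  by (simp add: nilalg_eq_iff)

lemma mult_scaleQ_right: "x * (q *\<^sub>Q y) = q *\<^sub>Q (x * y)"
  by (simp add: nilalg_eq_iff algebra_simps)

lemma length_tuple_mult [simp]: "length (v \<cdot>\<^sub>t M) = dim_col M"
  by (simp add: tuple_mult_def)

lemma nth_tuple_mult [simp]:
  "j < dim_col M \<Longrightarrow> (v \<cdot>\<^sub>t M) ! j = (\<Sum>i<dim_row M. M $$ (i,j) *\<^sub>Q v ! i)"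
  by (simp add: tuple_mult_def)

lemma tuple_mult_assoc:
  assumes "dim_col M = dim_row N"
  shows "(v \<cdot>\<^sub>t M) \<cdot>\<^sub>t N = v \<cdot>\<^sub>t (M * N)"
proof (rule nth_equalityI)
  fix j assume "j < length ((v \<cdot>\<^sub>t M) \<cdot>\<^sub>t N)"
  then have j: "j < dim_col N" by simp
  have "((v \<cdot>\<^sub>t M) \<cdot>\<^sub>t N) ! j =
      (\<Sum>k<dim_row N. \<Sum>i<dim_row M. (N $$ (k,j) * M $$ (i,k)) *\<^sub>Q v ! i)"
    using j assms by (simp add: Q.scale_sum_right)
  also have "\<dots> = (\<Sum>i<dim_row M. (\<Sum>k<dim_row N. M $$ (i,k) * N $$ (k,j)) *\<^sub>Q v ! i)"
    by (subst sum.swap) (simp add: Q.scale_sum_left mult.commute)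
  also have "\<dots> = (\<Sum>i<dim_row M. (M * N) $$ (i,j) *\<^sub>Q v ! i)"
    using j assms by (intro sum.cong refl) (simp add: scalar_prod_def atLeast0LessThan)
  finally show "((v \<cdot>\<^sub>t M) \<cdot>\<^sub>t N) ! j = (v \<cdot>\<^sub>t (M * N)) ! j"
    using j by simp
qed (simp add: assms)

lemma tuple_mult_one: "length v = n \<Longrightarrow> v \<cdot>\<^sub>t 1\<^sub>m n = v"
  by (rule nth_equalityI) (simp_all add: if_distrib[of "\<lambda>q. q *\<^sub>Q _"] cong: if_cong)

lemma map_mult_tuple_mult:
  "dim_row M = length v \<Longrightarrow> map (\<lambda>x. y * x) (v \<cdot>\<^sub>t M) = map (\<lambda>x. y * x) v \<cdot>\<^sub>t M"
  by (rule nth_equalityI) (simp_all add: sum_distrib_left mult_scaleQ_right)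

text \<open>
  Coefficients are functions on all of \<open>nat\<close>, of which only the values below the length
  matter; this spares a carrier for the coefficient tuples.
\<close>

definition zcomb :: "nilalg list \<Rightarrow> (nat \<Rightarrow> int) \<Rightarrow> nilalg" where
  "zcomb b c = (\<Sum>i<length b. of_int (c i) * b ! i)"

lemma zcomb_scaleQ: "zcomb b c = (\<Sum>i<length b. of_int (c i) *\<^sub>Q b ! i)"
  by (simp add: zcomb_def scaleQ_of_int)

lemma zcomb_diff: "zcomb b (\<lambda>i. c i - d i) = zcomb b c - zcomb b d"
  by (simp add: zcomb_def sum_subtractf algebra_simps)

lemma zcomb_sum_distinct:
  "distinct b \<Longrightarrow> zcomb b (\<lambda>i. u (b ! i)) = (\<Sum>v\<in>set b. of_int (u v) * v)"
  unfolding zcomb_def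
  by (rule sum.reindex_bij_betw[where g = "\<lambda>v. of_int (u v) * v"])
     (auto intro: bij_betw_nth)

lemma ex_index_fun:
  assumes "distinct b"
  shows "\<exists>u. \<forall>i<length b. u (b ! i) = c i"
proof
  show "\<forall>i<length b. c (THE j. j < length b \<and> b ! j = b ! i) = c i"
    using assms by (auto intro!: arg_cong[of _ _ c] the_equality simp: nth_eq_iff_index_eq)
qed

text \<open>
  The definition of a basis speaks of the \<^emph>\<open>set\<close> of entries. In terms of positions,
  distinctness need not be demanded separately: a repeated entry is the relation with
  coefficients \<open>1\<close> and \<open>-1\<close>.
\<close>

lemma is_Zbasis_iff_zcomb:
  "is_Zbasis b L \<longleftrightarrow>
    range (zcomb b) = L \<and> (\<forall>c. zcomb b c = 0 \<longrightarrow> (\<forall>i<length b. c i = 0))"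
proof (cases "distinct b")
  case True
  have zc: "\<exists>u. zcomb b c = (\<Sum>v\<in>set b. of_int (u v) * v) \<and> (\<forall>i<length b. u (b ! i) = c i)" for c
  proof -
    obtain u where u: "\<forall>i<length b. u (b ! i) = c i"
      using ex_index_fun[OF True] by blast
    then have "zcomb b c = zcomb b (\<lambda>i. u (b ! i))"
      by (simp add: zcomb_def)
    then show ?thesis using u zcomb_sum_distinct[OF True] by metis
  qed
  have "Z.span (set b) = range (zcomb b)"
    unfolding Z.span_finite[OF finite_set]
  proof (intro equalityI image_subsetI)
    fix u show "(\<Sum>v\<in>set b. of_int (u v) * v) \<in> range (zcomb b)"
      using zcomb_sum_distinct[OF True, of u] by (metis rangeI)
  next
    fix c show "zcomb b c \<in> range (\<lambda>u. \<Sum>v\<in>set b. of_int (u v) * v)"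
      using zc[of c] by blast
  qed
  moreover have "Z.independent (set b) \<longleftrightarrow> (\<forall>c. zcomb b c = 0 \<longrightarrow> (\<forall>i<length b. c i = 0))"
    unfolding Z.dependent_finite[OF finite_set]
  proof (intro iffI allI impI notI; (elim exE conjE)?)
    fix c i assume "\<nexists>u. (\<exists>v\<in>set b. u v \<noteq> 0) \<and> (\<Sum>v\<in>set b. of_int (u v) * v) = 0"
      and "zcomb b c = 0" "i < length b"
    then show "c i = 0" using zc[of c] by (metis nth_mem)
  next
    fix u assume "\<forall>c. zcomb b c = 0 \<longrightarrow> (\<forall>i<length b. c i = 0)"
      and "\<exists>v\<in>set b. u v \<noteq> 0" "(\<Sum>v\<in>set b. of_int (u v) * v) = 0"
    then show False using zcomb_sum_distinct[OF True, of u] by (metis in_set_conv_nth)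
  qed
  ultimately show ?thesis using True by (auto simp: is_Zbasis_def)
next
  case False
  then obtain i j where ij: "i < length b" "j < length b" "i \<noteq> j" "b ! i = b ! j"
    by (auto simp: distinct_conv_nth)
  define c :: "nat \<Rightarrow> int" where "c k = of_bool (k = i) - of_bool (k = j)" for k
  have "zcomb b c = zcomb b (\<lambda>k. of_bool (k = i)) - zcomb b (\<lambda>k. of_bool (k = j))"
    unfolding c_def by (rule zcomb_diff)
  also have "\<dots> = 0"
    using ij by (simp add: zcomb_def of_bool_def if_distrib[of of_int] if_distrib[of "\<lambda>q. q * _"] cong: if_cong)
  finally have "zcomb b c = 0" .
  moreover have "c i \<noteq> 0" using ij by (simp add: c_def)
  ultimately show ?thesis using False ij by (auto simp: is_Zbasis_def)
qed

lemma tuple_mult_of_int_nth: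
  assumes "dim_row P = length b" "j < dim_col P"
  shows "(b \<cdot>\<^sub>t map_mat rat_of_int P) ! j = zcomb b (\<lambda>i. P $$ (i,j))"
  using assms by (simp add: zcomb_def scaleQ_of_int)

lemma Zbasis_coeff_unique:
  assumes b: "is_Zbasis b L" and P: "P \<in> carrier_mat (length b) m" and P': "P' \<in> carrier_mat (length b) m"
    and eq: "b \<cdot>\<^sub>t map_mat rat_of_int P = b \<cdot>\<^sub>t map_mat rat_of_int P'"
  shows "P = P'"
proof (rule eq_matI)
  fix i j assume ij: "i < dim_row P'" "j < dim_col P'"
  have "zcomb b (\<lambda>i. P $$ (i,j)) = zcomb b (\<lambda>i. P' $$ (i,j))"
    using tuple_mult_of_int_nth[of P b j] tuple_mult_of_int_nth[of P' b j] P P' ij eq by auto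
  then have "zcomb b (\<lambda>i. P $$ (i,j) - P' $$ (i,j)) = 0"
    by (simp add: zcomb_diff)
  then show "P $$ (i,j) = P' $$ (i,j)"
    using b ij P' by (auto simp: is_Zbasis_iff_zcomb)
qed (use P P' in auto)

lemma Zbasis_coeff_exists:
  assumes b: "is_Zbasis b L" and v: "set v \<subseteq> L"
  obtains P where "P \<in> carrier_mat (length b) (length v)" "v = b \<cdot>\<^sub>t map_mat rat_of_int P"
proof -
  have "\<exists>c. v ! j = zcomb b c" if "j < length v" for j
  proof -
    have "v ! j \<in> range (zcomb b)"
      using b v nth_mem[OF that] unfolding is_Zbasis_iff_zcomb by blast
    then show ?thesis by blast
  qed
  then obtain c where c: "\<And>j. j < length v \<Longrightarrow> v ! j = zcomb b (c j)" by metis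
  define P where "P = mat (length b) (length v) (\<lambda>(i,j). c j i)"
  have P: "P \<in> carrier_mat (length b) (length v)" by (simp add: P_def)
  have "v = b \<cdot>\<^sub>t map_mat rat_of_int P"
  proof (rule nth_equalityI)
    fix j assume j: "j < length v"
    have "zcomb b (c j) = zcomb b (\<lambda>i. P $$ (i,j))"
      using j by (simp add: zcomb_def P_def)
    then show "v ! j = (b \<cdot>\<^sub>t map_mat rat_of_int P) ! j"
      using c[OF j] j P by (subst tuple_mult_of_int_nth) auto
  qed (simp add: P_def)
  then show ?thesis using that P by blast
qed

lemma Zbasis_subset: "is_Zbasis b L \<Longrightarrow> set b \<subseteq> L"
  by (auto simp: is_Zbasis_def intro: Z.span_base)

lemma tuple_mult_of_int_assoc:
  assumes "M \<in> carrier_mat n m" "N \<in> carrier_mat m l"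
  shows "(b \<cdot>\<^sub>t map_mat rat_of_int M) \<cdot>\<^sub>t map_mat rat_of_int N = b \<cdot>\<^sub>t map_mat rat_of_int (M * N)"
  using assms by (subst tuple_mult_assoc) (auto simp: of_int_hom.mat_hom_mult)

lemma mult_by_a_length: "mult_by_a b M \<Longrightarrow> length b = 3 \<and> M \<in> carrier_mat 3 3"
  unfolding mult_by_a_def by (auto dest: arg_cong[of _ _ length])

text \<open>
  Both transition matrices are integral because the two bases span the same lattice, and they
  are mutually inverse because coefficients are unique. Comparing two expressions of \<open>a b'\<close> in
  \<open>b\<close> gives \<open>M P = P M'\<close>.
\<close>

lemma change_of_basis_similar:
  assumes b: "is_Zbasis b L" "mult_by_a b M" and b': "is_Zbasis b' L" "mult_by_a b' M'"
  shows "similar_mat M' M"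
proof -
  let ?h = "map_mat rat_of_int"
  note len = mult_by_a_length[OF b(2)] mult_by_a_length[OF b'(2)]
  obtain P where P: "P \<in> carrier_mat 3 3" "b' = b \<cdot>\<^sub>t ?h P"
    using Zbasis_coeff_exists[OF b(1) Zbasis_subset[OF b'(1)]] len by metis
  obtain R where R: "R \<in> carrier_mat 3 3" "b = b' \<cdot>\<^sub>t ?h R"
    using Zbasis_coeff_exists[OF b'(1) Zbasis_subset[OF b(1)]] len by metis
  have one: "b \<cdot>\<^sub>t ?h (1\<^sub>m 3) = b" "b' \<cdot>\<^sub>t ?h (1\<^sub>m 3) = b'"
    using len by (simp_all add: of_int_hom.mat_hom_one tuple_mult_one)
  have "b \<cdot>\<^sub>t ?h (P * R) = b" "b' \<cdot>\<^sub>t ?h (R * P) = b'"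
    unfolding tuple_mult_of_int_assoc[OF P(1) R(1), symmetric]
      tuple_mult_of_int_assoc[OF R(1) P(1), symmetric]
    by (simp_all only: P(2)[symmetric] R(2)[symmetric])
  then have PR: "P * R = 1\<^sub>m 3" and RP: "R * P = 1\<^sub>m 3"
    using Zbasis_coeff_unique[OF b(1), of "P * R" 3 "1\<^sub>m 3"]
      Zbasis_coeff_unique[OF b'(1), of "R * P" 3 "1\<^sub>m 3"] P(1) R(1) len one by simp_all
  have "b \<cdot>\<^sub>t ?h (M * P) = map (\<lambda>x. gen_a * x) b'"
    using b(2) P len
    by (simp add: mult_by_a_def tuple_mult_of_int_assoc[of _ 3 3 _ 3, symmetric] map_mult_tuple_mult)
  also have "\<dots> = b \<cdot>\<^sub>t ?h (P * M')"
    using b'(2) P len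
    by (simp add: mult_by_a_def tuple_mult_of_int_assoc[of _ 3 3 _ 3, symmetric])
  finally have MP: "M * P = P * M'"
    using P len by (auto intro!: Zbasis_coeff_unique[OF b(1), of _ 3])
  have "R * M * P = R * (P * M')"
    using P R len MP by (simp add: assoc_mult_mat[of _ 3 3 _ 3 _ 3])
  also have "\<dots> = M'"
    using P(1) R(1) len RP left_mult_one_mat[of M' 3 3]
    by (simp add: assoc_mult_mat[of R 3 3 P 3 M' 3, symmetric] del: left_mult_one_mat)
  finally show ?thesis
    using P R len PR RP by (intro similar_matI[of _ _ R P 3]) auto
qed

text \<open>
  If \<open>M P = P N\<close> with \<open>P\<close> invertible over the integers, then \<open>b \<cdot> P\<close> is another basis of the
  same lattice, and \<open>a\<close> acts on it by \<open>N\<close>.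
\<close>

lemma similar_change_of_basis:
  assumes b: "is_Zbasis b L" "mult_by_a b M" and sim: "similar_mat N M"
  shows "\<exists>b'. is_Zbasis b' L \<and> mult_by_a b' N"
proof -
  let ?h = "map_mat rat_of_int"
  have len: "length b = 3" "M \<in> carrier_mat 3 3"
    using mult_by_a_length[OF b(2)] by auto
  obtain R P where "similar_mat_wit N M R P" using sim by (auto simp: similar_mat_def)
  then have "similar_mat_wit M N P R" by (rule similar_mat_wit_sym)
  from similar_mat_witD2[OF len(2) this]
  have car: "N \<in> carrier_mat 3 3" "P \<in> carrier_mat 3 3" "R \<in> carrier_mat 3 3"
    and PR: "P * R = 1\<^sub>m 3" and RP: "R * P = 1\<^sub>m 3" and M: "M = P * N * R" by auto
  define b' where "b' = b \<cdot>\<^sub>t ?h P"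
  have len': "length b' = 3" using car by (simp add: b'_def)
  have bb': "b = b' \<cdot>\<^sub>t ?h R"
    unfolding b'_def tuple_mult_of_int_assoc[OF car(2,3)] PR
    using len by (simp add: of_int_hom.mat_hom_one tuple_mult_one)
  have MP: "M * P = P * N"
    unfolding M using car RP by (subst assoc_mult_mat[of _ 3 3 _ 3 _ 3]) auto
  have "mult_by_a b' N"
    unfolding mult_by_a_def
  proof
    have "map (\<lambda>x. gen_a * x) b' = b \<cdot>\<^sub>t ?h (M * P)"
      unfolding b'_def using b(2) car len
      by (simp add: mult_by_a_def tuple_mult_of_int_assoc[symmetric] map_mult_tuple_mult)
    then show "map (\<lambda>x. gen_a * x) b' = b' \<cdot>\<^sub>t ?h N"
      unfolding MP b'_def using car by (simp add: tuple_mult_of_int_assoc)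
  qed (use car in auto)
  moreover have "is_Zbasis b' L"
  proof -
    have zc: "zcomb (v \<cdot>\<^sub>t ?h X) c = zcomb v (\<lambda>i. (X *\<^sub>v vec 3 c) $ i)"
      if "X \<in> carrier_mat 3 3" "length v = 3" for X v c
    proof -
      have "[zcomb (v \<cdot>\<^sub>t ?h X) c] = (v \<cdot>\<^sub>t ?h X) \<cdot>\<^sub>t ?h (mat 3 1 (\<lambda>(i,j). c i))"
        using that by (intro nth_equalityI)
          (simp_all add: zcomb_scaleQ)
      also have "\<dots> = v \<cdot>\<^sub>t ?h (X * mat 3 1 (\<lambda>(i,j). c i))"
        by (rule tuple_mult_of_int_assoc) (use that in auto)
      also have "\<dots> = [zcomb v (\<lambda>i. (X *\<^sub>v vec 3 c) $ i)]"
        using that by (intro nth_equalityI)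
          (simp_all add: zcomb_scaleQ scalar_prod_def)
      finally show ?thesis by simp
    qed
    have "range (zcomb b') = range (zcomb b)"
    proof (intro equalityI image_subsetI)
      fix c show "zcomb b' c \<in> range (zcomb b)"
        unfolding b'_def zc[OF car(2) len(1)] by blast
      show "zcomb b c \<in> range (zcomb b')"
        by (subst bb', subst zc[OF car(3) len']) blast
    qed
    moreover have "c i = 0" if "zcomb b' c = 0" "i < 3" for c i
    proof -
      have "\<forall>i<3. (P *\<^sub>v vec 3 c) $ i = 0"
        using that(1) b(1) len unfolding b'_def zc[OF car(2) len(1)] is_Zbasis_iff_zcomb by metis
      then have "P *\<^sub>v vec 3 c = 0\<^sub>v 3" using car by (intro eq_vecI) auto
      then have "R *\<^sub>v (P *\<^sub>v vec 3 c) = 0\<^sub>v 3" using car by auto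
      then have "vec 3 c = 0\<^sub>v 3"
        using car RP by (subst (asm) assoc_mult_mat_vec[symmetric]) (auto)
      then show ?thesis using that(2) by (metis index_vec index_zero_vec(1))
    qed
    ultimately show ?thesis using b(1) len' by (simp add: is_Zbasis_iff_zcomb)
  qed
  ultimately show ?thesis by blast
qed

section \<open>Lower triangular lattices and the invariant of the diagonal\<close>

text \<open>
  The lattice spanned by the columns \<open>(p, s, t)\<close>, \<open>(0, q, h)\<close>, \<open>(0, 0, r)\<close> of coordinates with
  respect to \<open>1, a, a\<^sup>2\<close>.
\<close>

definition tlat :: "rat \<Rightarrow> rat \<Rightarrow> rat \<Rightarrow> rat \<Rightarrow> rat \<Rightarrow> rat \<Rightarrow> nilalg set" where
  "tlat p s t q h r = {Elt (of_int i * p) (of_int i * s + of_int j * q)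
     (of_int i * t + of_int j * h + of_int k * r) | i j k. True}"

definition tmat :: "rat \<Rightarrow> rat \<Rightarrow> rat \<Rightarrow> rat \<Rightarrow> rat \<Rightarrow> rat \<Rightarrow> rat mat" where
  "tmat p s t q h r = mat_of_rows_list 3 [[p, 0, 0], [s, q, 0], [t, h, r]]"

lemma less_3_iff: "(i::nat) < 3 \<longleftrightarrow> i = 0 \<or> i = 1 \<or> i = 2"
  by auto

lemma sum_lessThan_3: "(\<Sum>i<(3::nat). f i) = f 0 + f 1 + f 2"
  by (simp add: eval_nat_numeral)

lemma tmat_index [simp]:
  "dim_row (tmat p s t q h r) = 3" "dim_col (tmat p s t q h r) = 3"
  "tmat p s t q h r $$ (0,0) = p" "tmat p s t q h r $$ (0,Suc 0) = 0" "tmat p s t q h r $$ (0,2) = 0"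
  "tmat p s t q h r $$ (Suc 0,0) = s" "tmat p s t q h r $$ (Suc 0,Suc 0) = q" "tmat p s t q h r $$ (Suc 0,2) = 0"
  "tmat p s t q h r $$ (2,0) = t" "tmat p s t q h r $$ (2,Suc 0) = h" "tmat p s t q h r $$ (2,2) = r"
  by (simp_all add: tmat_def mat_of_rows_list_def)

lemma upt_3: "[0..<3] = [0, 1, 2]"
  by (simp add: upt_rec)

lemma avec_tmat: "avec \<cdot>\<^sub>t tmat p s t q h r = [Elt p s t, Elt 0 q h, Elt 0 0 r]"
  unfolding avec_def gen_a_power2
  by (simp add: tuple_mult_def upt_3 sum_lessThan_3 nilalg_eq_iff)

lemma mem_tlat:
  "x \<in> tlat p s t q h r \<longleftrightarrow> (\<exists>i j k. c0 x = of_int i * p \<and> c1 x = of_int i * s + of_int j * q \<and>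
     c2 x = of_int i * t + of_int j * h + of_int k * r)"
  by (auto simp: tlat_def nilalg_eq_iff)

lemma is_Zbasis_triangular_iff:
  assumes "p \<noteq> 0" "q \<noteq> 0" "r \<noteq> 0"
  shows "is_Zbasis [Elt p s t, Elt 0 q h, Elt 0 0 r] L \<longleftrightarrow> L = tlat p s t q h r"
proof -
  let ?b = "[Elt p s t, Elt 0 q h, Elt 0 0 r]"
  have zc: "zcomb ?b c = Elt (of_int (c 0) * p) (of_int (c 0) * s + of_int (c 1) * q)
     (of_int (c 0) * t + of_int (c 1) * h + of_int (c 2) * r)" for c
    by (simp add: zcomb_def sum_lessThan_3 eval_nat_numeral nilalg_eq_iff)
  have "range (zcomb ?b) = tlat p s t q h r"
  proof (intro equalityI subsetI)
    fix x assume "x \<in> tlat p s t q h r"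
    then obtain i j k where x: "x = Elt (of_int i * p) (of_int i * s + of_int j * q)
       (of_int i * t + of_int j * h + of_int k * r)" by (auto simp: tlat_def)
    have "x = zcomb ?b (\<lambda>n. [i, j, k] ! n)" by (simp add: zc x)
    then show "x \<in> range (zcomb ?b)" by blast
  qed (auto simp: zc tlat_def)
  moreover have "\<forall>i<3. c i = 0" if "zcomb ?b c = 0" for c
    using that assms by (auto simp: zc nilalg_eq_iff less_3_iff)
  ultimately show ?thesis by (auto simp: is_Zbasis_iff_zcomb)
qed

lemma is_Zbasis_tmat_iff:
  assumes "p > 0" "q > 0" "r > 0"
  shows "is_Zbasis (avec \<cdot>\<^sub>t tmat p s t q h r) L \<longleftrightarrow> L = tlat p s t q h r"
  using assms by (simp add: avec_tmat is_Zbasis_triangular_iff)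

lemma full_lattice_tlat:
  assumes "p \<noteq> 0" "q \<noteq> 0" "r \<noteq> 0"
  shows "full_lattice (tlat p s t q h r)"
proof -
  let ?b = "[Elt p s t, Elt 0 q h, Elt 0 0 r]" and ?L = "tlat p s t q h r"
  have b: "is_Zbasis ?b ?L" using assms by (simp add: is_Zbasis_triangular_iff)
  have "x \<in> Q.span ?L" for x
  proof -
    define i where "i = c0 x / p"
    define j where "j = (c1 x - i * s) / q"
    define k where "k = (c2 x - i * t - j * h) / r"
    have "x = i *\<^sub>Q Elt p s t + j *\<^sub>Q Elt 0 q h + k *\<^sub>Q Elt 0 0 r"
      using assms by (simp add: nilalg_eq_iff i_def j_def k_def)
    moreover have "set ?b \<subseteq> Q.span ?L"
      using Zbasis_subset[OF b] Q.span_superset by blast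
    ultimately show ?thesis
      by (simp add: Q.span_add Q.span_scale)
  qed
  moreover have "Z.span (set ?b) = ?L" using b by (simp add: is_Zbasis_def)
  ultimately show ?thesis unfolding full_lattice_def by blast
qed

lemma tlat_subset_shift:
  "tlat p s t q h r \<subseteq>
   tlat p (s + of_int j * q) (t + of_int j * h + of_int k * r) q (h + of_int i * r) r"
proof
  fix x assume "x \<in> tlat p s t q h r"
  then obtain a b c where x: "c0 x = of_int a * p" "c1 x = of_int a * s + of_int b * q"
     "c2 x = of_int a * t + of_int b * h + of_int c * r" by (auto simp: mem_tlat)
  show "x \<in> tlat p (s + of_int j * q) (t + of_int j * h + of_int k * r) q (h + of_int i * r) r"
    unfolding mem_tlat
    by (rule exI[of _ a], rule exI[of _ "b - a * j"], rule exI[of _ "c - a * k - (b - a * j) * i"])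
       (simp add: x algebra_simps)
qed

text \<open>
  Integer multiples of later basis vectors may be added to earlier ones. By \<open>tlat_eqD\<close> this is
  the only freedom in the choice of a triangular basis with positive diagonal.
\<close>

lemma tlat_shift:
  "tlat p (s + of_int j * q) (t + of_int j * h + of_int k * r) q (h + of_int i * r) r
   = tlat p s t q h r"
proof (rule equalityI[OF _ tlat_subset_shift])
  have "s = s + of_int j * q + of_int (- j) * q"
    "t = (t + of_int j * h + of_int k * r) + of_int (- j) * (h + of_int i * r) + of_int (j * i - k) * r"
    "h = h + of_int i * r + of_int (- i) * r"
    by (simp_all add: algebra_simps)
  then show "tlat p (s + of_int j * q) (t + of_int j * h + of_int k * r) q (h + of_int i * r) r
    \<subseteq> tlat p s t q h r"
    using tlat_subset_shift[of p "s + of_int j * q" "t + of_int j * h + of_int k * r" q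
        "h + of_int i * r" r "- j" "j * i - k" "- i"] by metis
qed

lemma pos_multiple_antisym:
  assumes "p > 0" "p' > 0" "p = of_int i * p'" "p' = of_int j * (p::rat)"
  shows "p = p'"
proof -
  have le: "y \<le> x" if "x > 0" "y > 0" "x = of_int k * y" for x y :: rat and k
  proof -
    have "k \<ge> 1" using that by (auto simp: zero_less_mult_iff)
    then show ?thesis using that by (simp add: mult_le_cancel_right1)
  qed
  show ?thesis using le[OF assms(1,2,3)] le[OF assms(2,1,4)] by simp
qed

text \<open>
  The diagonal is intrinsic: \<open>p\<close>, \<open>q\<close>, \<open>r\<close> are the positive generators of the images of the
  lattice, of its part with first coordinate \<open>0\<close>, and of its part inside \<open>\<rat> a\<^sup>2\<close> under the
  respective leading coordinate.
\<close>

lemma tlat_eqD: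
  assumes pos: "p > 0" "q > 0" "r > 0" "p' > 0" "q' > 0" "r' > 0"
    and eq: "tlat p s t q h r = tlat p' s' t' q' h' r'"
  shows "p' = p \<and> q' = q \<and> r' = r \<and> (\<exists>i j k. s' = s + of_int j * q \<and>
    t' = t + of_int j * h + of_int k * r \<and> h' = h + of_int i * r)"
proof -
  have diag: "Elt p s t \<in> tlat p s t q h r" "Elt 0 q h \<in> tlat p s t q h r" "Elt 0 0 r \<in> tlat p s t q h r"
    if "p > 0" "q > 0" "r > 0" for p s t q h r
    using Zbasis_subset[of "[Elt p s t, Elt 0 q h, Elt 0 0 r]" "tlat p s t q h r"] that
    by (simp_all add: is_Zbasis_triangular_iff)
  have div: "(\<exists>i. p' = of_int i * p) \<and> (\<exists>i. q' = of_int i * q) \<and> (\<exists>i. r' = of_int i * r)"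
    if "p > 0" "q > 0" "r > 0" "p' > 0" "q' > 0" "r' > 0"
      "tlat p s t q h r = tlat p' s' t' q' h' r'" for p s t q h r p' s' t' q' h' r'
    using diag[OF that(4-6), where s = s' and t = t' and h = h'] that unfolding that(7)[symmetric] mem_tlat by auto
  have same: "p' = p" "q' = q" "r' = r"
    using div[OF pos eq] div[OF pos(4-6) pos(1-3) eq[symmetric]] pos pos_multiple_antisym by metis+
  have "Elt p' s' t' \<in> tlat p s t q h r" "Elt 0 q' h' \<in> tlat p s t q h r"
    unfolding eq by (rule diag; fact)+
  then show ?thesis using same pos unfolding mem_tlat by auto
qed

lemma ex_reduced_residue:
  assumes "(m::rat) > 0"
  shows "\<exists>i. - m / 2 < x + of_int i * m \<and> x + of_int i * m \<le> m / 2"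
proof -
  \<comment> \<open>Rounding half-integers down makes the right end of the interval the closed one.\<close>
  define c where "c = \<lceil>x / m - 1 / 2\<rceil>"
  have "of_int c - 1 < x / m - 1 / 2" "x / m - 1 / 2 \<le> of_int c"
    unfolding c_def by linarith+
  then have "(of_int c - 1 / 2) * m < x" "x \<le> (of_int c + 1 / 2) * m"
    using assms by (simp_all add: field_simps)
  then show ?thesis by (intro exI[of _ "- c"]) (simp add: algebra_simps)
qed

lemma reduced_residue_unique:
  assumes "(m::rat) > 0" "- m / 2 < x" "x \<le> m / 2" "- m / 2 < x + of_int i * m" "x + of_int i * m \<le> m / 2"
  shows "i = 0"
proof -
  have "of_int i * m < 1 * m" "(- 1) * m < of_int i * m" using assms by linarith+
  then have "of_int i < (1::rat)" "(-1::rat) < of_int i"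
    using assms(1) by (metis mult_less_cancel_right_pos)+
  then show ?thesis by linarith
qed

lemma lower_reduced_tmat_iff:
  "lower_reduced (tmat p s t q h r) \<longleftrightarrow> p > 0 \<and> q > 0 \<and> r > 0 \<and>
     - q / 2 < s \<and> s \<le> q / 2 \<and> - r / 2 < t \<and> t \<le> r / 2 \<and> - r / 2 < h \<and> h \<le> r / 2"
  unfolding lower_reduced_def numeral_3_eq_3 All_less_Suc
  apply (simp only: carrier_mat_def tmat_index[unfolded numeral_2_eq_2] numeral_3_eq_3 mem_Collect_eq)
  apply (simp only: less_Suc_eq not_less_zero simp_thms nat.inject nat.distinct)
  apply blast
  done

lemma lower_reduced_imp_tmat:
  assumes "lower_reduced \<beta>"
  obtains p s t q h r where "\<beta> = tmat p s t q h r"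
proof
  show "\<beta> = tmat (\<beta> $$ (0,0)) (\<beta> $$ (1,0)) (\<beta> $$ (2,0)) (\<beta> $$ (1,1)) (\<beta> $$ (2,1)) (\<beta> $$ (2,2))"
    using assms by (intro eq_matI) (auto simp: less_3_iff lower_reduced_def)
qed

text \<open>
  Delta is defined through the reduced basis. Its existence follows by shifting the entries below
  the diagonal into the half-open intervals, its uniqueness from \<open>tlat_eqD\<close>. Since shifts leave
  the diagonal alone, Delta can be computed from any triangular basis.
\<close>

lemma Delta_tlat:
  assumes pos: "p > 0" "q > 0" "r > 0"
  shows "Delta (tlat p s t q h r) = q\<^sup>2 / (p * r)"
proof -
  let ?L = "tlat p s t q h r"
  obtain i where i: "- r / 2 < h + of_int i * r" "h + of_int i * r \<le> r / 2"
    using ex_reduced_residue pos by blast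
  obtain j where j: "- q / 2 < s + of_int j * q" "s + of_int j * q \<le> q / 2"
    using ex_reduced_residue pos by blast
  obtain k where k: "- r / 2 < t + of_int j * h + of_int k * r" "t + of_int j * h + of_int k * r \<le> r / 2"
    using ex_reduced_residue pos by blast
  define s' t' h' where st: "s' = s + of_int j * q" "t' = t + of_int j * h + of_int k * r"
    "h' = h + of_int i * r"
  let ?\<beta> = "tmat p s' t' q h' r"
  have L: "?L = tlat p s' t' q h' r" unfolding st tlat_shift ..
  have "(THE \<beta>. lower_reduced \<beta> \<and> is_Zbasis (avec \<cdot>\<^sub>t \<beta>) ?L) = ?\<beta>"
  proof (rule the_equality)
    have "lower_reduced ?\<beta>"
      unfolding lower_reduced_tmat_iff st by (intro conjI pos i j k)
    moreover have "is_Zbasis (avec \<cdot>\<^sub>t ?\<beta>) ?L"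
      unfolding is_Zbasis_tmat_iff[OF pos] by (rule L)
    ultimately show "lower_reduced ?\<beta> \<and> is_Zbasis (avec \<cdot>\<^sub>t ?\<beta>) ?L" ..
  next
    fix \<beta> assume \<beta>: "lower_reduced \<beta> \<and> is_Zbasis (avec \<cdot>\<^sub>t \<beta>) ?L"
    then obtain p2 s2 t2 q2 h2 r2 where t: "\<beta> = tmat p2 s2 t2 q2 h2 r2"
      using lower_reduced_imp_tmat by blast
    have b: "p2 > 0" "q2 > 0" "r2 > 0" "- q2 / 2 < s2" "s2 \<le> q2 / 2" "- r2 / 2 < t2" "t2 \<le> r2 / 2"
      "- r2 / 2 < h2" "h2 \<le> r2 / 2"
      using \<beta> unfolding t lower_reduced_tmat_iff by blast+
    have "is_Zbasis (avec \<cdot>\<^sub>t tmat p2 s2 t2 q2 h2 r2) ?L" using \<beta> unfolding t ..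
    then have "tlat p s' t' q h' r = tlat p2 s2 t2 q2 h2 r2"
      unfolding is_Zbasis_tmat_iff[OF b(1-3)] using L by metis
    from tlat_eqD[OF pos b(1-3) this] obtain i' j' k' where
      e: "p2 = p" "q2 = q" "r2 = r" "s2 = s' + of_int j' * q" "t2 = t' + of_int j' * h' + of_int k' * r"
         "h2 = h' + of_int i' * r" by auto
    have j0: "j' = 0"
      by (rule reduced_residue_unique[OF pos(2) j]) (use b e st in auto)
    moreover have "i' = 0"
      by (rule reduced_residue_unique[OF pos(3) i]) (use b e st in auto)
    moreover have "k' = 0"
      by (rule reduced_residue_unique[OF pos(3) k]) (use b e st j0 in auto)
    ultimately show "\<beta> = ?\<beta>" by (simp add: t e)
  qed
  then show ?thesis by (simp add: Delta_def)
qed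

section \<open>Every full lattice has a lower triangular basis\<close>

text \<open>
  A nonzero subgroup of \<open>\<rat>\<close> with a common denominator is generated by its least positive
  element, as division with remainder shows. The single
  closure condition \<open>x + i y \<in> H\<close> expresses being a subgroup once \<open>H\<close> is nonempty.
\<close>

lemma rat_discrete_subgroup_cyclic:
  fixes H :: "rat set" and N :: int
  assumes N: "N > 0" "\<And>x. x \<in> H \<Longrightarrow> of_int N * x \<in> \<int>"
    and cl: "\<And>x y i. x \<in> H \<Longrightarrow> y \<in> H \<Longrightarrow> x + of_int i * y \<in> H"
    and ne: "x0 \<in> H" "x0 \<noteq> 0"
  obtains g where "g > 0" "g \<in> H" "\<And>x. x \<in> H \<Longrightarrow> \<exists>i. x = of_int i * g"
proof -
  have N0: "rat_of_int N > 0" using N(1) by simp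
  have zero: "0 \<in> H" using cl[OF ne(1) ne(1), of "-1"] by simp
  have H: "\<exists>z. x = of_int z / of_int N" if xH: "x \<in> H" for x
  proof -
    obtain z where "of_int N * x = of_int z" using N(2)[OF xH] by (rule Ints_cases)
    then show ?thesis using N0 by (intro exI[of _ z]) (simp add: field_simps)
  qed
  \<comment> \<open>\<open>P n\<close> says that \<open>n/N\<close> is a positive element of the subgroup.\<close>
  define P where "P n \<longleftrightarrow> n > 0 \<and> of_nat n / of_int N \<in> H" for n :: nat
  have ex: "\<exists>n. P n"
  proof -
    obtain z where z: "x0 = of_int z / of_int N" using H[OF ne(1)] by blast
    have "of_int \<bar>z\<bar> / of_int N \<in> H"
      using ne(1) cl[OF zero ne(1), of "-1"] by (simp add: z abs_if)
    moreover have "z \<noteq> 0" using z ne by auto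
    ultimately show ?thesis
      unfolding P_def by (intro exI[of _ "nat \<bar>z\<bar>"]) (simp add: of_nat_nat)
  qed
  define m where "m = (LEAST n. P n)"
  have m: "m > 0" "of_nat m / of_int N \<in> H"
    using LeastI_ex[OF ex] unfolding m_def P_def by auto
  show ?thesis
  proof (rule that)
    show "of_nat m / of_int N > (0::rat)" using m N0 by simp
    show "of_nat m / of_int N \<in> H" by (fact m)
    fix x assume x: "x \<in> H"
    obtain z where z: "x = of_int z / of_int N" using H[OF x] by blast
    have "x + of_int (- (z div int m)) * (of_nat m / of_int N)
        = of_int (z - (z div int m) * int m) / of_int N"
      using N0 by (simp add: z field_simps)
    also have "z - (z div int m) * int m = z mod int m"
      by (simp add: minus_div_mult_eq_mod)
    finally have "of_int (z mod int m) / of_int N \<in> H"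
      using cl[OF x m(2), of "- (z div int m)"] by simp
    moreover have zm: "0 \<le> z mod int m" "z mod int m < int m" using m(1) by simp_all
    ultimately have "nat (z mod int m) > 0 \<Longrightarrow> P (nat (z mod int m))"
      unfolding P_def by (simp add: of_nat_nat)
    moreover have "\<not> P (nat (z mod int m))"
      using zm not_less_Least[of "nat (z mod int m)" P] unfolding m_def[symmetric] by auto
    ultimately have "z mod int m = 0" using zm by linarith
    then have "z = (z div int m) * int m" using div_mult_mod_eq[of z "int m"] by simp
    then have "x = of_int (z div int m) * (of_nat m / of_int N)"
      unfolding z by (metis of_int_mult of_int_of_nat_eq times_divide_eq_right)
    then show "\<exists>i. x = of_int i * (of_nat m / of_int N)" by blast
  qed
qed

lemma rat_as_fraction:
  fixes x :: rat
  obtains a b :: int where "x = of_int a / of_int b" "b > 0"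
  by (cases x rule: Rat_cases) (auto simp: Fract_of_int_quotient)

lemma finite_rat_common_denominator:
  "finite (F :: rat set) \<Longrightarrow> \<exists>N::int. N > 0 \<and> (\<forall>q\<in>F. of_int N * q \<in> \<int>)"
proof (induction F rule: finite_induct)
  case (insert x F)
  then obtain N :: int where N: "N > 0" "\<forall>q\<in>F. of_int N * q \<in> \<int>" by blast
  obtain a b where ab: "x = of_int a / of_int b" "b > 0"
    by (rule rat_as_fraction)
  have "of_int (b * N) * x = of_int (N * a)" using ab by simp
  then have "of_int (b * N) * x \<in> \<int>" by (metis Ints_of_int)
  moreover have "of_int (b * N) * q \<in> \<int>" if "q \<in> F" for q
    using N that Ints_mult[of "of_int b" "of_int N * q"] by (simp add: mult.assoc)
  ultimately show ?case using N ab by (intro exI[of _ "b * N"]) auto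
qed (auto intro: exI[of _ 1])

lemma full_lattice_add_multiple:
  assumes "full_lattice L" "x \<in> L" "y \<in> L"
  shows "x + of_int i * y \<in> L"
proof -
  obtain S where "L = Z.span S" using assms(1) unfolding full_lattice_def by blast
  then show ?thesis using assms Z.span_add[of x S] Z.span_scale[of y S i] by simp
qed

lemma full_lattice_common_denominator:
  assumes "full_lattice L"
  obtains N :: int where "N > 0"
    "\<And>x. x \<in> L \<Longrightarrow> of_int N * c0 x \<in> \<int> \<and> of_int N * c1 x \<in> \<int> \<and> of_int N * c2 x \<in> \<int>"
proof -
  obtain S where S: "finite S" "Z.span S = L" using assms unfolding full_lattice_def by blast
  then obtain N :: int where N: "N > 0" "\<forall>q\<in>c0 ` S \<union> c1 ` S \<union> c2 ` S. of_int N * q \<in> \<int>"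
    using finite_rat_common_denominator[of "c0 ` S \<union> c1 ` S \<union> c2 ` S"] by auto
  let ?T = "{x. of_int N * c0 x \<in> \<int> \<and> of_int N * c1 x \<in> \<int> \<and> of_int N * c2 x \<in> \<int>}"
  have "Z.subspace ?T"
    by (rule Z.subspaceI)
       (auto simp: distrib_left mult.left_commute[of "of_int N"] intro: Ints_add Ints_mult)
  then have "L \<subseteq> ?T" unfolding S(2)[symmetric] using N by (intro Z.span_minimal) auto
  then show ?thesis using that N(1) by blast
qed

text \<open>
  Since \<open>L\<close> spans \<open>A\<close> over \<open>\<rat>\<close>, every element has a positive integer multiple in \<open>L\<close>. Applied
  to \<open>1\<close>, \<open>a\<close>, \<open>a\<^sup>2\<close> this shows that none of the three projections used for the triangular basis
  is zero.
\<close>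

lemma full_lattice_absorbs:
  assumes L: "full_lattice L"
  shows "\<exists>m::int. m > 0 \<and> of_int m * y \<in> L"
proof -
  let ?T = "{y. \<exists>m::int. m > 0 \<and> of_int m * y \<in> L}"
  obtain S where S: "L = Z.span S" using L unfolding full_lattice_def by blast
  have mult: "of_int k * x \<in> L" if "x \<in> L" for k x
    using that unfolding S by (rule Z.span_scale)
  have "Q.subspace ?T"
  proof (rule Q.subspaceI)
    show "0 \<in> ?T" using Z.span_zero[of S] by (auto simp: S intro!: exI[of _ 1])
    fix x y assume "x \<in> ?T" "y \<in> ?T"
    then obtain m n where mn: "m > 0" "of_int m * x \<in> L" "n > 0" "of_int n * y \<in> L" by auto
    have "of_int n * (of_int m * x) + of_int m * (of_int n * y) \<in> L"
      using full_lattice_add_multiple[OF L mult[OF mn(2)] mn(4)] by blast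
    then have "of_int (m * n) * (x + y) \<in> L" by (simp add: algebra_simps)
    then show "x + y \<in> ?T" using mn by (auto intro!: exI[of _ "m * n"])
  next
    fix c :: rat and x assume "x \<in> ?T"
    then obtain m where m: "m > 0" "of_int m * x \<in> L" by auto
    obtain a b where ab: "c = of_int a / of_int b" "b > 0"
      by (rule rat_as_fraction)
    have "of_int (m * b) * (c *\<^sub>Q x) = of_int a * (of_int m * x)"
      using ab by (simp add: nilalg_eq_iff)
    then show "c *\<^sub>Q x \<in> ?T" using mult[OF m(2), of a] m ab by (auto intro!: exI[of _ "m * b"])
  qed
  moreover have "L \<subseteq> ?T" by (auto intro!: exI[of _ 1])
  ultimately have "Q.span L \<subseteq> ?T" by (rule Q.span_minimal[rotated])
  then show ?thesis using L unfolding full_lattice_def by blast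
qed

text \<open>
  The three coordinate projections of the filtration \<open>L \<supseteq> L \<inter> (\<rat> a + \<rat> a\<^sup>2) \<supseteq> L \<inter> \<rat> a\<^sup>2\<close>
  are discrete and nonzero, hence cyclic; preimages of positive generators form the basis.
\<close>

lemma full_lattice_triangular_basis:
  assumes L: "full_lattice L"
  obtains p s t q h r where "p > 0" "q > 0" "r > 0" "L = tlat p s t q h r"
proof -
  note add = full_lattice_add_multiple[OF L]
  obtain N :: int where N: "N > 0"
    "\<And>x. x \<in> L \<Longrightarrow> of_int N * c0 x \<in> \<int> \<and> of_int N * c1 x \<in> \<int> \<and> of_int N * c2 x \<in> \<int>"
    using full_lattice_common_denominator[OF L] by blast
  let ?L1 = "{x \<in> L. c0 x = 0}" and ?L2 = "{x \<in> L. c0 x = 0 \<and> c1 x = 0}"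
  obtain m0 m1 m2 :: int where m: "m0 > 0" "of_int m0 * 1 \<in> L" "m1 > 0" "of_int m1 * gen_a \<in> L"
    "m2 > 0" "of_int m2 * Elt 0 0 1 \<in> L"
    using full_lattice_absorbs[OF L] by metis
  have "c0 (of_int m0 * 1) \<in> c0 ` L" "c1 (of_int m1 * gen_a) \<in> c1 ` ?L1"
    "c2 (of_int m2 * Elt 0 0 1) \<in> c2 ` ?L2"
    using m by (intro imageI CollectI conjI; simp)+
  then have nz: "of_int m0 \<in> c0 ` L" "of_int m1 \<in> c1 ` ?L1" "of_int m2 \<in> c2 ` ?L2"
    by simp_all
  obtain p where p: "p > 0" "p \<in> c0 ` L" "\<And>x. x \<in> c0 ` L \<Longrightarrow> \<exists>i. x = of_int i * p"
  proof (rule rat_discrete_subgroup_cyclic[OF N(1) _ _ nz(1)])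
    show "x + of_int i * y \<in> c0 ` L" if xy: "x \<in> c0 ` L" "y \<in> c0 ` L" for x y i
    proof -
      obtain x' y' where "x' \<in> L" "y' \<in> L" "x = c0 x'" "y = c0 y'" using xy by blast
      then show ?thesis using add[of x' y' i] by (intro image_eqI[of _ _ "x' + of_int i * y'"]) auto
    qed
  qed (use N m in auto)
  obtain q where q: "q > 0" "q \<in> c1 ` ?L1" "\<And>x. x \<in> c1 ` ?L1 \<Longrightarrow> \<exists>i. x = of_int i * q"
  proof (rule rat_discrete_subgroup_cyclic[OF N(1) _ _ nz(2)])
    show "x + of_int i * y \<in> c1 ` ?L1" if xy: "x \<in> c1 ` ?L1" "y \<in> c1 ` ?L1" for x y i
    proof -
      obtain x' y' where "x' \<in> ?L1" "y' \<in> ?L1" "x = c1 x'" "y = c1 y'" using xy by blast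
      then show ?thesis using add[of x' y' i] by (intro image_eqI[of _ _ "x' + of_int i * y'"]) auto
    qed
  qed (use N m in auto)
  obtain r where r: "r > 0" "r \<in> c2 ` ?L2" "\<And>x. x \<in> c2 ` ?L2 \<Longrightarrow> \<exists>i. x = of_int i * r"
  proof (rule rat_discrete_subgroup_cyclic[OF N(1) _ _ nz(3)])
    show "x + of_int i * y \<in> c2 ` ?L2" if xy: "x \<in> c2 ` ?L2" "y \<in> c2 ` ?L2" for x y i
    proof -
      obtain x' y' where "x' \<in> ?L2" "y' \<in> ?L2" "x = c2 x'" "y = c2 y'" using xy by blast
      then show ?thesis using add[of x' y' i] by (intro image_eqI[of _ _ "x' + of_int i * y'"]) auto
    qed
  qed (use N m in auto)
  obtain v0 v1 v2 where v: "v0 \<in> L" "c0 v0 = p" "v1 \<in> L" "c0 v1 = 0" "c1 v1 = q"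
    "v2 \<in> L" "c0 v2 = 0" "c1 v2 = 0" "c2 v2 = r"
    using p(2) q(2) r(2) by auto
  have "L = tlat p (c1 v0) (c2 v0) q (c2 v1) r"
  proof (intro equalityI subsetI)
    fix x assume x: "x \<in> L"
    obtain i where i: "c0 x = of_int i * p" using p(3)[of "c0 x"] x by blast
    define x1 where "x1 = x + of_int (- i) * v0"
    have x1: "x1 \<in> L" "c0 x1 = 0" unfolding x1_def using add[OF x v(1), of "- i"] i v by simp_all
    obtain j where j: "c1 x1 = of_int j * q" using q(3)[of "c1 x1"] x1 by blast
    define x2 where "x2 = x1 + of_int (- j) * v1"
    have x2: "x2 \<in> L" "c0 x2 = 0" "c1 x2 = 0"
      unfolding x2_def using add[OF x1(1) v(3), of "- j"] j v x1 by simp_all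
    obtain k where k: "c2 x2 = of_int k * r" using r(3)[of "c2 x2"] x2 by blast
    show "x \<in> tlat p (c1 v0) (c2 v0) q (c2 v1) r"
      unfolding mem_tlat using i j k
      by - (rule exI[of _ i], rule exI[of _ j], rule exI[of _ k], auto simp: x1_def x2_def algebra_simps)
  next
    fix x assume "x \<in> tlat p (c1 v0) (c2 v0) q (c2 v1) r"
    then obtain i j k where x: "c0 x = of_int i * p" "c1 x = of_int i * c1 v0 + of_int j * q"
      "c2 x = of_int i * c2 v0 + of_int j * c2 v1 + of_int k * r" by (auto simp: mem_tlat)
    have "x = v0 + of_int (i - 1) * v0 + of_int j * v1 + of_int k * v2"
      using x v by (simp add: nilalg_eq_iff algebra_simps)
    then show "x \<in> L" using add v by metis
  qed
  then show ?thesis using that p(1) q(1) r(1) by blast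
qed

section \<open>Units and epsilon-classes\<close>

text \<open>
  An element with nonzero constant coefficient is a scalar plus a nilpotent element, and its inverse
  is the finite geometric series.
\<close>

lemma unit_iff: "u dvd 1 \<longleftrightarrow> c0 u \<noteq> 0" for u :: nilalg
proof
  assume "u dvd 1"
  then obtain v where "1 = u * v" by (auto simp: dvd_def)
  then have "c0 u * c0 v = 1" by (metis nilalg_sel(4) nilalg_sel(16))
  then show "c0 u \<noteq> 0" by auto
next
  assume u: "c0 u \<noteq> 0"
  have "1 = u * Elt (1 / c0 u) (- c1 u / c0 u ^ 2) (c1 u ^ 2 / c0 u ^ 3 - c2 u / c0 u ^ 2)"
    using u by (simp add: nilalg_eq_iff field_simps power2_eq_square power3_eq_cube)
  then show "u dvd 1" by (rule dvdI)
qed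

lemma full_lattice_uminus: "full_lattice L \<Longrightarrow> x \<in> L \<Longrightarrow> - x \<in> L"
  unfolding full_lattice_def by (auto intro: Z.span_neg)

lemma image_mult_tlat:
  "(\<lambda>x. u * x) ` tlat p s t q h r =
   tlat (c0 u * p) (c0 u * s + c1 u * p) (c0 u * t + c1 u * s + c2 u * p)
     (c0 u * q) (c0 u * h + c1 u * q) (c0 u * r)"
proof (intro equalityI subsetI)
  fix y assume "y \<in> (\<lambda>x. u * x) ` tlat p s t q h r"
  then obtain x where "y = u * x" and x: "x \<in> tlat p s t q h r" by blast
  moreover obtain i j k where "c0 x = of_int i * p" "c1 x = of_int i * s + of_int j * q"
     "c2 x = of_int i * t + of_int j * h + of_int k * r" using x by (auto simp: mem_tlat)
  ultimately show "y \<in> tlat (c0 u * p) (c0 u * s + c1 u * p) (c0 u * t + c1 u * s + c2 u * p)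
     (c0 u * q) (c0 u * h + c1 u * q) (c0 u * r)"
    unfolding mem_tlat
    by - (rule exI[of _ i], rule exI[of _ j], rule exI[of _ k], simp add: algebra_simps)
next
  fix y assume "y \<in> tlat (c0 u * p) (c0 u * s + c1 u * p) (c0 u * t + c1 u * s + c2 u * p)
     (c0 u * q) (c0 u * h + c1 u * q) (c0 u * r)"
  then obtain i j k where
    "c0 y = of_int i * (c0 u * p)" "c1 y = of_int i * (c0 u * s + c1 u * p) + of_int j * (c0 u * q)"
     "c2 y = of_int i * (c0 u * t + c1 u * s + c2 u * p) + of_int j * (c0 u * h + c1 u * q)
       + of_int k * (c0 u * r)" unfolding mem_tlat by blast
  then have "y = u * Elt (of_int i * p) (of_int i * s + of_int j * q)
     (of_int i * t + of_int j * h + of_int k * r)"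
    by (simp add: nilalg_eq_iff algebra_simps)
  then show "y \<in> (\<lambda>x. u * x) ` tlat p s t q h r"
    unfolding tlat_def by blast
qed

lemma full_lattice_image_mult:
  assumes "full_lattice L" "c0 u \<noteq> 0"
  shows "full_lattice ((\<lambda>x. u * x) ` L)"
proof -
  obtain p s t q h r where "p > 0" "q > 0" "r > 0" "L = tlat p s t q h r"
    by (rule full_lattice_triangular_basis[OF assms(1)])
  then show ?thesis using assms(2) by (simp add: image_mult_tlat full_lattice_tlat)
qed

text \<open>
  Because \<open>L = -L\<close>, the unit can be taken with positive constant coefficient, so that it preserves
  the positivity of the diagonal of a triangular basis.
\<close>

lemma eps_rel_iff:
  "(L, L') \<in> eps_rel \<longleftrightarrow> full_lattice L \<and> (\<exists>u. c0 u > 0 \<and> L' = (\<lambda>x. u * x) ` L)"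
proof
  assume "(L, L') \<in> eps_rel"
  then obtain u where L: "full_lattice L" and u: "c0 u \<noteq> 0" "L' = (\<lambda>x. u * x) ` L"
    by (auto simp: eps_rel_def unit_iff)
  have "(\<lambda>x. - u * x) ` L = (\<lambda>x. u * x) ` uminus ` L"
    by (simp add: image_image)
  also have "uminus ` L = L"
    using full_lattice_uminus[OF L] by (force intro: image_eqI[of _ _ "- _"])
  finally have neg: "L' = (\<lambda>x. - u * x) ` L" using u by simp
  have "\<exists>u. c0 u > 0 \<and> L' = (\<lambda>x. u * x) ` L"
  proof (cases "c0 u > 0")
    case True
    then show ?thesis using u(2) by blast
  next
    case False
    then have "c0 (- u) > 0" using u(1) by simp
    then show ?thesis using neg by blast
  qed
  then show "full_lattice L \<and> (\<exists>u. c0 u > 0 \<and> L' = (\<lambda>x. u * x) ` L)" using L by blast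
next
  assume "full_lattice L \<and> (\<exists>u. c0 u > 0 \<and> L' = (\<lambda>x. u * x) ` L)"
  then obtain u where u: "full_lattice L" "c0 u > 0" "L' = (\<lambda>x. u * x) ` L" by blast
  then show "(L, L') \<in> eps_rel"
    using full_lattice_image_mult[of L u] by (auto simp: eps_rel_def unit_iff intro!: exI[of _ u])
qed

lemma equiv_eps_rel: "equiv {L. full_lattice L} eps_rel"
proof (rule equivI)
  show "eps_rel \<subseteq> {L. full_lattice L} \<times> {L. full_lattice L}"
    by (auto simp: eps_rel_def)
  show "refl_on {L. full_lattice L} eps_rel"
    by (auto simp: refl_on_def eps_rel_def intro!: exI[of _ 1])
  show "sym eps_rel"
  proof (rule symI)
    fix L L' assume "(L, L') \<in> eps_rel"
    then obtain u where u: "full_lattice L" "full_lattice L'" "u dvd 1" "L' = (\<lambda>x. u * x) ` L"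
      by (auto simp: eps_rel_def)
    then obtain v where v: "1 = u * v" by (auto simp: dvd_def)
    have "v * (u * x) = x" for x
      using v by (metis mult.assoc mult.commute mult_1_left)
    then have "L = (\<lambda>x. v * x) ` L'" by (simp add: u image_image)
    moreover have "v dvd 1" using v by (metis dvd_triv_right)
    ultimately show "(L', L) \<in> eps_rel" using u by (auto simp: eps_rel_def)
  qed
  show "trans eps_rel"
  proof (rule transI)
    fix L L' L'' assume "(L, L') \<in> eps_rel" "(L', L'') \<in> eps_rel"
    then obtain u v where "full_lattice L" "full_lattice L''" "u dvd 1" "v dvd 1"
      "L' = (\<lambda>x. u * x) ` L" "L'' = (\<lambda>x. v * x) ` L'" by (auto simp: eps_rel_def)
    moreover have "v * u dvd 1" using calculation by (metis mult_dvd_mono mult_1_right)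
    ultimately show "(L, L'') \<in> eps_rel"
      by (auto simp: eps_rel_def image_image mult.assoc intro!: exI[of _ "v * u"])
  qed
qed

text \<open>
  A unit scales all three diagonal entries by its constant coefficient, and Delta is homogeneous of
  degree \<open>0\<close> in them.
\<close>

lemma Delta_eps_invariant:
  assumes "(L, L') \<in> eps_rel"
  shows "Delta L' = Delta L"
proof -
  obtain u where u: "full_lattice L" "c0 u > 0" "L' = (\<lambda>x. u * x) ` L"
    using assms by (auto simp: eps_rel_iff)
  obtain p s t q h r where "p > 0" "q > 0" "r > 0" "L = tlat p s t q h r"
    by (rule full_lattice_triangular_basis[OF u(1)])
  then show ?thesis
    using u by (simp add: image_mult_tlat Delta_tlat power2_eq_square)
qed

lemma order_of_eps_invariant:
  assumes "(L, L') \<in> eps_rel"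
  shows "order_of L' = order_of L"
proof -
  have sub: "order_of L \<subseteq> order_of L'" if rel: "(L, L') \<in> eps_rel" for L L'
  proof -
    obtain u where "L' = (\<lambda>x. u * x) ` L" using rel by (auto simp: eps_rel_iff)
    then show ?thesis
      by (auto simp: order_of_def mult.left_commute[of _ u] image_subset_iff)
  qed
  show ?thesis using sub assms equiv_eps_rel by (meson equivE subset_antisym symE)
qed

lemma eps_classE:
  assumes "C \<in> eps_classes" "L \<in> C"
  shows "C = eps_rel `` {L}" "full_lattice L"
proof -
  obtain L0 where L0: "full_lattice L0" "C = eps_rel `` {L0}"
    using assms(1) unfolding eps_classes_def by (auto elim: quotientE)
  then have r: "(L0, L) \<in> eps_rel" using assms(2) by auto
  show "C = eps_rel `` {L}" using equiv_class_eq[OF equiv_eps_rel r] L0 by simp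
  show "full_lattice L" using r by (auto simp: eps_rel_def)
qed

lemma eps_class_self:
  "full_lattice L \<Longrightarrow> L \<in> eps_rel `` {L}" "full_lattice L \<Longrightarrow> eps_rel `` {L} \<in> eps_classes"
  using equiv_class_self[OF equiv_eps_rel] by (auto simp: eps_classes_def intro: quotientI)

lemma eps_class_nonempty: "C \<in> eps_classes \<Longrightarrow> \<exists>L. L \<in> C"
  using eps_class_self unfolding eps_classes_def by (auto elim!: quotientE)

lemma Delta_class_eq:
  assumes "C \<in> eps_classes" "L \<in> C"
  shows "Delta_class C = Delta L"
proof -
  have "Delta L' = Delta L" if "L' \<in> C" for L'
    using Delta_eps_invariant[of L L'] eps_classE(1)[OF assms] that by blast
  then have "Delta ` C = {Delta L}" using assms(2) by blast
  then show ?thesis by (simp add: Delta_class_def)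
qed

text \<open>
  The triangular lattices whose first basis vector is \<open>1\<close>.
\<close>

abbreviation nlat :: "rat \<Rightarrow> rat \<Rightarrow> rat \<Rightarrow> nilalg set" where
  "nlat g h k \<equiv> tlat 1 0 0 g h k"

text \<open>
  Multiply by the inverse of the first vector of a triangular basis.
\<close>

lemma full_lattice_eps_nlat:
  assumes "full_lattice L"
  obtains g h k where "g > 0" "k > 0" "(L, nlat g h k) \<in> eps_rel"
proof -
  obtain p s t q h r where L: "p > 0" "q > 0" "r > 0" "L = tlat p s t q h r"
    by (rule full_lattice_triangular_basis[OF assms])
  \<comment> \<open>The inverse of the first basis vector \<open>p + s a + t a\<^sup>2\<close>.\<close>
  define u where "u = Elt (1 / p) (- s / p ^ 2) (s ^ 2 / p ^ 3 - t / p ^ 2)"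
  have "(\<lambda>x. u * x) ` L = nlat (q / p) (h / p - s * q / p ^ 2) (r / p)"
    unfolding L(4) image_mult_tlat
    using L(1) by (simp add: u_def field_simps power2_eq_square power3_eq_cube)
  then have "(L, nlat (q / p) (h / p - s * q / p ^ 2) (r / p)) \<in> eps_rel"
    using assms L(1) unfolding eps_rel_iff by (intro conjI exI[of _ u]) (auto simp: u_def)
  then show ?thesis using that L by (metis divide_pos_pos)
qed

text \<open>
  A normalising unit \<open>u\<close> has constant coefficient \<open>1\<close> and lies in the second lattice, being the
  image of \<open>1\<close>; so its \<open>a\<close>-coefficient is \<open>x g\<close> for an integer \<open>x\<close>, and \<open>u (g a + h a\<^sup>2)\<close> has
  \<open>a\<^sup>2\<close>-coefficient \<open>h + x g\<^sup>2\<close>. The summand \<open>y k\<close> is the freedom in the choice of the basis.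
  This is why the normal form confines \<open>h\<close> to an interval of length \<open>gcd\<^sub>\<rat> (g\<^sup>2, k)\<close>.
\<close>

lemma nlat_eps_iff:
  assumes pos: "g > 0" "k > 0" "g' > 0" "k' > 0"
  shows "(nlat g h k, nlat g' h' k') \<in> eps_rel \<longleftrightarrow>
    g' = g \<and> k' = k \<and> (\<exists>x y. h' = h + of_int x * g\<^sup>2 + of_int y * k)"
proof
  assume "(nlat g h k, nlat g' h' k') \<in> eps_rel"
  then obtain u where u: "c0 u > 0"
    "nlat g' h' k' = tlat (c0 u) (c1 u) (c2 u) (c0 u * g) (c0 u * h + c1 u * g) (c0 u * k)"
    by (auto simp: eps_rel_iff image_mult_tlat)
  have pos': "c0 u * g > 0" "c0 u * k > 0" using u pos by simp_all
  have "(1::rat) > 0" by simp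
  from tlat_eqD[OF this pos(3,4) u(1) pos' u(2)]
  have e0: "c0 u = 1" "c0 u * g = g'" "c0 u * k = k'"
    and "\<exists>i j. c1 u = 0 + of_int j * g' \<and> c0 u * h + c1 u * g = h' + of_int i * k'"
    by blast+
  then obtain i j where ij: "c1 u = 0 + of_int j * g'" "c0 u * h + c1 u * g = h' + of_int i * k'"
    by blast
  have e: "g' = g" "k' = k" using e0 by simp_all
  have "h + of_int j * g * g = h' + of_int i * k" using ij(2) unfolding ij(1) e e0(1) by simp
  then have "h' = h + of_int j * g\<^sup>2 + of_int (- i) * k"
    by (simp add: power2_eq_square algebra_simps)
  then show "g' = g \<and> k' = k \<and> (\<exists>x y. h' = h + of_int x * g\<^sup>2 + of_int y * k)"
    using e by blast
next
  assume "g' = g \<and> k' = k \<and> (\<exists>x y. h' = h + of_int x * g\<^sup>2 + of_int y * k)"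
  then obtain x y where e: "g' = g" "k' = k" "h' = h + of_int x * g\<^sup>2 + of_int y * k" by blast
  \<comment> \<open>The \<open>a\<^sup>2\<close>-coefficient is chosen so that \<open>u = 1 + x (g a + h' a\<^sup>2)\<close> lies in the target lattice.\<close>
  define u where "u = Elt 1 (of_int x * g) (of_int x * h')"
  have "(\<lambda>x. u * x) ` nlat g h k = tlat 1 (0 + of_int x * g) (0 + of_int x * h' + of_int 0 * k) g
      (h' + of_int (- y) * k) k"
    unfolding image_mult_tlat by (simp add: u_def e power2_eq_square mult.assoc)
  also have "\<dots> = nlat g' h' k'" unfolding tlat_shift by (simp add: e)
  finally show "(nlat g h k, nlat g' h' k') \<in> eps_rel"
    unfolding eps_rel_iff using pos full_lattice_tlat[of 1 g k 0 0 h]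
    by (intro conjI exI[of _ u]) (auto simp: u_def)
qed

lemma mem_nlat:
  "x \<in> nlat g h k \<longleftrightarrow> (\<exists>i j l. c0 x = of_int i \<and> c1 x = of_int j * g \<and> c2 x = of_int j * h + of_int l * k)"
  by (simp add: mem_tlat)

text \<open>
  As \<open>1\<close> is in the lattice, the order is contained in it. A member \<open>i + j (g a + h a\<^sup>2) + l k a\<^sup>2\<close>
  maps \<open>g a + h a\<^sup>2\<close> into the lattice iff \<open>j g\<^sup>2\<close> is a multiple of \<open>k\<close>, and with
  \<open>g\<^sup>2/k = n/d\<close> in lowest terms this means \<open>d dvd j\<close>.
\<close>

lemma order_of_nlat:
  assumes pos: "g > 0" "k > 0" "d > 0" and cop: "coprime n d"
    and nd: "of_int d * g\<^sup>2 = of_int n * k"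
  shows "order_of (nlat g h k) = nlat (of_int d * g) (of_int d * h) k"
proof (intro equalityI subsetI)
  fix x assume "x \<in> order_of (nlat g h k)"
  then have mult: "x * y \<in> nlat g h k" if "y \<in> nlat g h k" for y
    using that by (auto simp: order_of_def)
  have "1 \<in> nlat g h k" unfolding mem_nlat by (rule exI[of _ 1], rule exI[of _ 0], rule exI[of _ 0]) simp
  from mult[OF this] obtain i j l where
    x: "c0 x = of_int i" "c1 x = of_int j * g" "c2 x = of_int j * h + of_int l * k"
    unfolding mem_nlat by auto
  have "Elt 0 g h \<in> nlat g h k"
    unfolding mem_nlat by (rule exI[of _ 0], rule exI[of _ 1], rule exI[of _ 0]) simp
  from mult[OF this] obtain j' l' where
    "of_int i * g = of_int j' * g" "of_int i * h + of_int j * g * g = of_int j' * h + of_int l' * k"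
    unfolding mem_nlat by (auto simp: x)
  then have jl: "of_int j * g\<^sup>2 = of_int l' * k" using pos by (simp add: power2_eq_square)
  have "of_int (j * n) * k = of_int j * (of_int d * g\<^sup>2)" by (simp add: nd)
  also have "\<dots> = of_int (d * l') * k" using jl by (simp add: algebra_simps)
  finally have "rat_of_int (j * n) = of_int (d * l')" using pos by simp
  then have "j * n = d * l'" using of_int_eq_iff by blast
  then have "d dvd j" using cop by (metis coprime_commute coprime_dvd_mult_left_iff dvd_triv_left)
  then obtain j1 where "j = d * j1" by blast
  then show "x \<in> nlat (of_int d * g) (of_int d * h) k"
    unfolding mem_nlat
    by - (rule exI[of _ i], rule exI[of _ j1], rule exI[of _ l], simp add: x)
next
  fix x assume "x \<in> nlat (of_int d * g) (of_int d * h) k"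
  then obtain i j l where x: "c0 x = of_int i" "c1 x = of_int j * (of_int d * g)"
    "c2 x = of_int j * (of_int d * h) + of_int l * k" unfolding mem_nlat by auto
  have "x * y \<in> nlat g h k" if y: "y \<in> nlat g h k" for y
  proof -
    obtain a b c where y: "c0 y = of_int a" "c1 y = of_int b * g" "c2 y = of_int b * h + of_int c * k"
      using y unfolding mem_nlat by auto
    have "c1 x * c1 y = of_int (j * b) * (of_int d * g\<^sup>2)" by (simp add: x y power2_eq_square)
    then have cc: "c1 x * c1 y = of_int (j * b * n) * k" by (simp add: nd)
    show ?thesis
      unfolding mem_nlat nilalg_sel cc
      by (rule exI[of _ "i * a"], rule exI[of _ "i * b + j * d * a"], rule exI[of _ "i * c + l * a + j * b * n"])
         (simp add: x y algebra_simps)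
  qed
  then show "x \<in> order_of (nlat g h k)" by (auto simp: order_of_def)
qed

lemma is_order_nlat:
  assumes pos: "g > 0" "k > 0" and n: "g\<^sup>2 = of_int n * k"
  shows "is_order (nlat g h k)"
proof -
  have o: "order_of (nlat g h k) = nlat g h k"
    using order_of_nlat[of g k 1 n h] assms by simp
  have "1 \<in> nlat g h k" unfolding mem_nlat by (rule exI[of _ 1], rule exI[of _ 0], rule exI[of _ 0]) simp
  moreover have "x * y \<in> nlat g h k" if "x \<in> nlat g h k" "y \<in> nlat g h k" for x y
    using that by (subst (asm) (1) o[symmetric]) (auto simp: order_of_def)
  ultimately show ?thesis
    using full_lattice_tlat[of 1 g k 0 0 h] pos by (auto simp: is_order_def)
qed

section \<open>The normal form lattices, their orders and their classes\<close>

text \<open>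
  The parameters are chosen so that \<open>rep_mat m1 m2 m3\<close> is the matrix of \<open>a\<close> on this lattice; see
  \<open>mult_by_a_rep_basis\<close>.
\<close>

definition rep_lattice :: "nat \<Rightarrow> nat \<Rightarrow> nat \<Rightarrow> nilalg set" where
  "rep_lattice m1 m2 m3 =
     nlat (1 / of_nat m2) (of_nat m3 / (of_nat m1 * of_nat m2 ^ 2)) (1 / (of_nat m1 * of_nat m2))"

lemma full_lattice_rep_lattice: "m1 > 0 \<Longrightarrow> m2 > 0 \<Longrightarrow> full_lattice (rep_lattice m1 m2 m3)"
  unfolding rep_lattice_def by (rule full_lattice_tlat) auto

text \<open>
  With \<open>e = 1/(m\<^sub>1 m\<^sub>2\<^sup>2)\<close> one has \<open>g\<^sup>2 = m\<^sub>1 e\<close>, \<open>k = m\<^sub>2 e\<close> and \<open>h = m\<^sub>3 e\<close>, so that the rational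
  criterion \<open>nlat_eps_iff\<close> becomes an integral one.
\<close>

lemma rep_lattice_eps_iff:
  assumes pos: "m1 > 0" "m2 > 0" "m1' > 0" "m2' > 0"
  shows "(rep_lattice m1 m2 m3, rep_lattice m1' m2' m3') \<in> eps_rel \<longleftrightarrow>
    m1' = m1 \<and> m2' = m2 \<and> (\<exists>x y. int m3' = int m3 + x * int m1 + y * int m2)"
proof -
  let ?q = "of_nat :: nat \<Rightarrow> rat"
  have q: "?q m1 > 0" "?q m2 > 0" "?q m1' > 0" "?q m2' > 0" using pos by simp_all
  have "?q m3' / (?q m1 * ?q m2 ^ 2) = ?q m3 / (?q m1 * ?q m2 ^ 2)
      + of_int x * (1 / ?q m2)\<^sup>2 + of_int y * (1 / (?q m1 * ?q m2)) \<longleftrightarrow>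
    int m3' = int m3 + x * int m1 + y * int m2" for x y
  proof -
    define e where "e = 1 / (?q m1 * ?q m2 ^ 2)"
    have "e > 0" using q by (simp add: e_def)
    have "?q n / (?q m1 * ?q m2 ^ 2) = ?q n * e" for n by (simp add: e_def)
    moreover have "(1 / ?q m2)\<^sup>2 = ?q m1 * e" "1 / (?q m1 * ?q m2) = ?q m2 * e"
      using q by (simp_all add: e_def field_simps power2_eq_square)
    ultimately have "?q m3' / (?q m1 * ?q m2 ^ 2) = ?q m3 / (?q m1 * ?q m2 ^ 2)
      + of_int x * (1 / ?q m2)\<^sup>2 + of_int y * (1 / (?q m1 * ?q m2)) \<longleftrightarrow>
      ?q m3' * e = (?q m3 + of_int x * ?q m1 + of_int y * ?q m2) * e"
      by (simp only: algebra_simps)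
    also have "\<dots> \<longleftrightarrow> rat_of_int (int m3') = rat_of_int (int m3 + x * int m1 + y * int m2)"
      using \<open>e > 0\<close> by simp
    finally show ?thesis unfolding of_int_eq_iff .
  qed
  moreover have "1 / ?q m2' = 1 / ?q m2 \<and> 1 / (?q m1' * ?q m2') = 1 / (?q m1 * ?q m2) \<longleftrightarrow>
      m1' = m1 \<and> m2' = m2"
    using q by auto
  ultimately show ?thesis
    unfolding rep_lattice_def using q by (subst nlat_eps_iff) auto
qed

lemma rep_lattice_eps_unique:
  assumes pos: "m1 > 0" "m2 > 0" "m1' > 0" "m2' > 0" and m3: "m3 < gcd m1 m2" "m3' < gcd m1' m2'"
    and rel: "(rep_lattice m1 m2 m3, rep_lattice m1' m2' m3') \<in> eps_rel"
  shows "m1' = m1 \<and> m2' = m2 \<and> m3' = m3"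
proof -
  obtain x y where e: "m1' = m1" "m2' = m2" "int m3' = int m3 + x * int m1 + y * int m2"
    using rel unfolding rep_lattice_eps_iff[OF pos] by blast
  let ?g = "int (gcd m1 m2)"
  have "?g dvd int m1" "?g dvd int m2" by auto
  then have "?g dvd x * int m1 + y * int m2" by (intro dvd_add dvd_mult)
  then have "int m3' mod ?g = int m3 mod ?g"
    unfolding mod_eq_dvd_iff e(3) by (simp add: algebra_simps)
  then have "m3' = m3" using m3 e by simp
  then show ?thesis using e by simp
qed

lemma Delta_rep_lattice:
  "m1 > 0 \<Longrightarrow> m2 > 0 \<Longrightarrow> Delta (rep_lattice m1 m2 m3) = of_nat m1 / of_nat m2"
  unfolding rep_lattice_def by (subst Delta_tlat) (auto simp: field_simps power2_eq_square)

text \<open>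
  Here \<open>g\<^sup>2/k = n\<^sub>1/d\<^sub>1\<close> is in lowest terms, so the order arises by multiplying \<open>g\<close> and \<open>h\<close> by
  \<open>d\<^sub>1\<close>. The third parameter survives unchanged.
\<close>

lemma order_of_rep_lattice:
  assumes pos: "n1 > 0" "d1 > 0" "c > 0" and cop: "coprime n1 d1"
  shows "order_of (rep_lattice (n1 * c) (d1 * c) m) = rep_lattice (n1 * d1 * c) c m"
proof -
  let ?q = "of_nat :: nat \<Rightarrow> rat"
  have q: "?q n1 > 0" "?q d1 > 0" "?q c > 0" using pos by simp_all
  have "coprime (int n1) (int d1)" using cop by simp
  moreover have "of_int (int d1) * (1 / ?q (d1 * c))\<^sup>2 = of_int (int n1) * (1 / (?q (n1 * c) * ?q (d1 * c)))"
    using q by (simp add: field_simps power2_eq_square)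
  ultimately have "order_of (rep_lattice (n1 * c) (d1 * c) m) =
      nlat (of_int (int d1) * (1 / ?q (d1 * c)))
        (of_int (int d1) * (?q m / (?q (n1 * c) * ?q (d1 * c) ^ 2))) (1 / (?q (n1 * c) * ?q (d1 * c)))"
    unfolding rep_lattice_def using pos by (intro order_of_nlat[where n = "int n1"]) auto
  also have "of_int (int d1) * (1 / ?q (d1 * c)) = 1 / ?q c" using q by simp
  also have "of_int (int d1) * (?q m / (?q (n1 * c) * ?q (d1 * c) ^ 2)) = ?q m / (?q (n1 * d1 * c) * ?q c ^ 2)"
    using q by (simp add: field_simps power2_eq_square)
  also have "1 / (?q (n1 * c) * ?q (d1 * c)) = 1 / (?q (n1 * d1 * c) * ?q c)"
    by (simp add: ac_simps)
  finally show ?thesis unfolding rep_lattice_def .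
qed

text \<open>
  For these parameters \<open>g\<^sup>2/k = n\<close> is an integer, so the lattice equals its own order.
\<close>

lemma is_order_rep_lattice:
  assumes "n > 0" "c > 0"
  shows "is_order (rep_lattice (n * c) c m)"
  unfolding rep_lattice_def
  by (rule is_order_nlat[where n = "int n"]) (use assms in \<open>auto simp: field_simps power2_eq_square\<close>)

lemma Lambda_a_subset_rep_lattice:
  assumes "n > 0" "c > 0"
  shows "Lambda_a \<subseteq> rep_lattice (n * c) c m"
proof -
  let ?L = "rep_lattice (n * c) c m" and ?q = "of_nat :: nat \<Rightarrow> rat"
  have q: "?q n > 0" "?q c > 0" using assms by simp_all
  obtain S where S: "?L = Z.span S"
    using full_lattice_rep_lattice[of "n * c" c m] assms unfolding full_lattice_def by auto
  have "1 \<in> ?L" unfolding rep_lattice_def mem_nlat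
    by (rule exI[of _ 1], rule exI[of _ 0], rule exI[of _ 0]) simp
  moreover have "gen_a \<in> ?L" unfolding rep_lattice_def mem_nlat
    by (rule exI[of _ 0], rule exI[of _ "int c"], rule exI[of _ "- int m"])
       (use q in \<open>simp add: field_simps power2_eq_square\<close>)
  moreover have "gen_a ^ 2 \<in> ?L" unfolding rep_lattice_def mem_nlat gen_a_power2
    by (rule exI[of _ 0], rule exI[of _ 0], rule exI[of _ "int (n * c * c)"])
       (use q in \<open>simp add: field_simps\<close>)
  ultimately show ?thesis
    unfolding Lambda_a_def S by (intro Z.span_minimal) (auto simp: Z.subspace_span)
qed

text \<open>
  Normalise to \<open>nlat g h k\<close>. Stability under \<open>a\<close>, applied to \<open>1\<close> and to \<open>g a + h a\<^sup>2\<close>, gives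
  \<open>1 = j g\<close>, \<open>0 = j h + l k\<close> and \<open>g = i k\<close> with integers \<open>i, j, l\<close>. Then \<open>m\<^sub>1 = i\<close>, \<open>m\<^sub>2 = j\<close>, and
  \<open>m\<^sub>3\<close> is the residue of \<open>-l\<close> modulo \<open>gcd m\<^sub>1 m\<^sub>2\<close>.
\<close>

lemma full_lattice_eps_rep_lattice:
  assumes L: "full_lattice L" and a: "Lambda_a \<subseteq> order_of L"
  obtains m1 m2 m3 where "m1 > 0" "m2 > 0" "m3 < gcd m1 m2" "(L, rep_lattice m1 m2 m3) \<in> eps_rel"
proof -
  obtain g h k where n: "g > 0" "k > 0" "(L, nlat g h k) \<in> eps_rel"
    using full_lattice_eps_nlat[OF L] by metis
  have "gen_a \<in> Lambda_a" unfolding Lambda_a_def by (rule Z.span_base) simp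
  then have "gen_a \<in> order_of (nlat g h k)"
    using a order_of_eps_invariant[OF n(3)] by auto
  then have mult: "gen_a * y \<in> nlat g h k" if "y \<in> nlat g h k" for y
    using that by (auto simp: order_of_def)
  have "1 \<in> nlat g h k" unfolding mem_nlat
    by (rule exI[of _ 1], rule exI[of _ 0], rule exI[of _ 0]) simp
  from mult[OF this] obtain j l where jl: "1 = of_int j * g" "0 = of_int j * h + of_int l * k"
    unfolding mem_nlat by auto
  have "Elt 0 g h \<in> nlat g h k" unfolding mem_nlat
    by (rule exI[of _ 0], rule exI[of _ 1], rule exI[of _ 0]) simp
  from mult[OF this] obtain i where i: "g = of_int i * k"
    unfolding mem_nlat using n(1) by auto
  have "of_int j * g > 0" using jl(1) by simp
  then have "j > 0" using n(1) by (simp add: zero_less_mult_iff)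
  moreover have "of_int i * k > 0" using i n(1) by simp
  then have "i > 0" using n(2) by (simp add: zero_less_mult_iff)
  ultimately obtain m1 m2 where m: "i = int m1" "j = int m2" "m1 > 0" "m2 > 0"
    by (metis of_nat_0_less_iff zero_less_imp_eq_int)
  let ?q = "of_nat :: nat \<Rightarrow> rat"
  have q: "?q m1 > 0" "?q m2 > 0" using m by simp_all
  have g: "g = 1 / ?q m2" using jl(1) q m by (simp add: field_simps)
  have k: "k = 1 / (?q m1 * ?q m2)" using i q m g by (simp add: field_simps)
  define c where "c = int (gcd m1 m2)"
  define m3 where "m3 = nat (- l mod c)"
  have c0: "c > 0" using m by (simp add: c_def)
  have m3: "int m3 = - l mod c" using c0 by (simp add: m3_def)
  then have "int m3 < c" using c0 by simp
  then have m3less: "m3 < gcd m1 m2" by (simp add: c_def)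
  \<comment> \<open>By Bezout, a change of \<open>m3\<close> by a multiple of the gcd is realised by an \<open>\<epsilon>\<close>-equivalence.\<close>
  obtain u v where "u * int m1 + v * int m2 = c"
    using bezout_int[of "int m1" "int m2"] by (auto simp: c_def)
  then have "int m3 = - l - (- l div c) * (u * int m1 + v * int m2)"
    unfolding m3 using minus_div_mult_eq_mod[of "- l" c] by simp
  then have "int m3 = - l + (- (- l div c) * u) * int m1 + (- (- l div c) * v) * int m2"
    by (simp add: algebra_simps)
  then obtain x y where xy: "int m3 = - l + x * int m1 + y * int m2" by blast
  have xy': "?q m3 = - of_int l + of_int x * ?q m1 + of_int y * ?q m2"
    using arg_cong[OF xy, of rat_of_int] by simp
  have h: "h = - of_int l / (?q m1 * ?q m2 ^ 2)"
    using jl(2) q m k by (simp add: field_simps power2_eq_square eq_neg_iff_add_eq_0)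
  have "(nlat g h k, rep_lattice m1 m2 m3) \<in> eps_rel"
    unfolding rep_lattice_def
  proof (subst nlat_eps_iff)
    have "?q m3 / (?q m1 * ?q m2 ^ 2) = h + of_int x * g\<^sup>2 + of_int y * k"
      unfolding xy' h k g using q by (simp add: field_simps power2_eq_square)
    then show "1 / ?q m2 = g \<and> 1 / (?q m1 * ?q m2) = k \<and>
      (\<exists>x y. ?q m3 / (?q m1 * ?q m2 ^ 2) = h + of_int x * g\<^sup>2 + of_int y * k)"
      using g k by blast
  qed (use n q in auto)
  then have "(L, rep_lattice m1 m2 m3) \<in> eps_rel"
    using n(3) equiv_eps_rel by (meson equivE transD)
  then show ?thesis using that m m3less by blast
qed

lemma order_of_order:
  assumes "is_order \<Lambda>"
  shows "order_of \<Lambda> = \<Lambda>"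
proof (intro equalityI subsetI)
  fix x assume "x \<in> order_of \<Lambda>"
  then have "x * 1 \<in> \<Lambda>" using assms unfolding order_of_def is_order_def by blast
  then show "x \<in> \<Lambda>" by simp
next
  fix x assume "x \<in> \<Lambda>"
  then show "x \<in> order_of \<Lambda>" using assms by (auto simp: order_of_def is_order_def)
qed

lemma gcd_cofactors:
  fixes m1 m2 :: nat
  assumes "m1 > 0" "m2 > 0"
  obtains n1 d1 where "n1 > 0" "d1 > 0" "coprime n1 d1" "m1 = n1 * gcd m1 m2" "m2 = d1 * gcd m1 m2"
proof
  show "coprime (m1 div gcd m1 m2) (m2 div gcd m1 m2)" using assms by (intro div_gcd_coprime) auto
qed (use assms in \<open>auto simp: div_greater_zero_iff\<close>)

text \<open>
  An order is its own order, and orders are constant on \<open>\<epsilon>\<close>-classes. So it is enough to know the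
  order of one representative \<open>rep_lattice m1 m2 m3\<close> of its class.
\<close>

lemma order_containing_a_eq_rep_lattice:
  assumes "is_order \<Lambda>" "Lambda_a \<subseteq> \<Lambda>"
  obtains n2 n3 n4 where "n2 > 0" "n3 > 0" "n4 < n2" "\<Lambda> = rep_lattice (n3 * n2) n2 n4"
proof -
  have \<Lambda>: "full_lattice \<Lambda>" "order_of \<Lambda> = \<Lambda>"
    using assms order_of_order by (auto simp: is_order_def)
  obtain m1 m2 m3 where m: "m1 > 0" "m2 > 0" "m3 < gcd m1 m2"
    "(\<Lambda>, rep_lattice m1 m2 m3) \<in> eps_rel"
    using full_lattice_eps_rep_lattice[of \<Lambda>] \<Lambda> assms(2) by metis
  define c where "c = gcd m1 m2"
  obtain n1 d1 where nd: "n1 > 0" "d1 > 0" "coprime n1 d1" "m1 = n1 * c" "m2 = d1 * c"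
    using gcd_cofactors[OF m(1,2)] unfolding c_def by metis
  have c: "c > 0" and m3c: "m3 < c" using m by (simp_all add: c_def)
  have "\<Lambda> = order_of (rep_lattice m1 m2 m3)" using order_of_eps_invariant[OF m(4)] \<Lambda> by simp
  also have "\<dots> = rep_lattice (n1 * d1 * c) c m3"
    unfolding nd(4,5) by (rule order_of_rep_lattice) (use nd c in auto)
  finally show ?thesis using that[of c "n1 * d1" m3] nd(1,2) c m3c by simp
qed

text \<open>
  Equal lattices are \<open>\<epsilon>\<close>-equivalent, and here the third parameter is below the greatest common
  divisor of the first two.
\<close>

lemma rep_lattice_order_inj:
  assumes "n > 0" "c > 0" "m < c" "n' > 0" "c' > 0" "m' < c'"
    and "rep_lattice (n * c) c m = rep_lattice (n' * c') c' m'"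
  shows "n' = n \<and> c' = c \<and> m' = m"
proof -
  have "(rep_lattice (n * c) c m, rep_lattice (n' * c') c' m') \<in> eps_rel"
    using assms equiv_eps_rel full_lattice_rep_lattice[of "n * c" c m]
    by (auto elim!: equivE simp: refl_on_def)
  from rep_lattice_eps_unique[OF _ _ _ _ _ _ this] show ?thesis using assms by auto
qed

text \<open>
  A class with the given order has a representative \<open>rep_lattice (n * c) (d * c) m3\<close> with coprime
  \<open>n, d\<close>. Its Delta gives \<open>n/d\<close>, hence \<open>n\<close> and \<open>d\<close>; its order
  \<open>rep_lattice (n * d * c) c m3\<close> then gives \<open>c\<close> and \<open>m3\<close>.
\<close>

lemma class_with_iff:
  assumes pos: "n1 > 0" "d1 > 0" "n2 > 0" "n4 < n2" and cop: "coprime n1 d1"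
  shows "class_with (rep_lattice (n1 * d1 * n2) n2 n4) (of_nat n1 / of_nat d1) C \<longleftrightarrow>
    C = eps_rel `` {rep_lattice (n1 * n2) (d1 * n2) n4}"
proof
  let ?R = "rep_lattice (n1 * n2) (d1 * n2) n4"
  have R: "full_lattice ?R" using pos by (intro full_lattice_rep_lattice) auto
  assume C: "C = eps_rel `` {?R}"
  have "C \<in> eps_classes" "?R \<in> C" unfolding C by (intro eps_class_self R)+
  moreover have "order_of L = rep_lattice (n1 * d1 * n2) n2 n4" if "L \<in> C" for L
    using that order_of_eps_invariant[of ?R L] order_of_rep_lattice[OF pos(1-3) cop] unfolding C by auto
  moreover have "Delta_class C = of_nat n1 / of_nat d1"
    using Delta_class_eq[OF \<open>C \<in> eps_classes\<close> \<open>?R \<in> C\<close>] pos by (simp add: Delta_rep_lattice)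
  ultimately show "class_with (rep_lattice (n1 * d1 * n2) n2 n4) (of_nat n1 / of_nat d1) C"
    unfolding class_with_def by blast
next
  let ?\<Lambda> = "rep_lattice (n1 * d1 * n2) n2 n4"
  assume "class_with ?\<Lambda> (of_nat n1 / of_nat d1) C"
  then have C: "C \<in> eps_classes" "\<And>L. L \<in> C \<Longrightarrow> order_of L = ?\<Lambda>"
    "Delta_class C = of_nat n1 / of_nat d1" unfolding class_with_def by auto
  obtain L where L: "L \<in> C" using eps_class_nonempty[OF C(1)] by blast
  have "Lambda_a \<subseteq> order_of L"
    unfolding C(2)[OF L] using pos by (intro Lambda_a_subset_rep_lattice) auto
  then obtain m1 m2 m3 where m: "m1 > 0" "m2 > 0" "m3 < gcd m1 m2"
    "(L, rep_lattice m1 m2 m3) \<in> eps_rel"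
    using full_lattice_eps_rep_lattice eps_classE(2)[OF C(1) L] by metis
  define c where "c = gcd m1 m2"
  obtain n d where nd: "n > 0" "d > 0" "coprime n d" "m1 = n * c" "m2 = d * c"
    using gcd_cofactors[OF m(1,2)] unfolding c_def by metis
  have c: "c > 0" and m3c: "m3 < c" using m by (simp_all add: c_def)
  let ?R = "rep_lattice m1 m2 m3"
  have R: "?R \<in> C" using m(4) eps_classE(1)[OF C(1) L] by blast
  have "of_nat n / of_nat d = (of_nat n1 / of_nat d1 :: rat)"
    using Delta_class_eq[OF C(1) R] C(3) c Delta_rep_lattice[OF m(1,2), of m3] nd(1,2)
    by (simp add: nd(4,5))
  then have "rat_of_nat (n * d1) = of_nat (n1 * d)"
    using nd pos by (simp add: field_simps)
  then have "n * d1 = n1 * d" unfolding of_nat_eq_iff .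
  then have "n = n1 \<and> d = d1"
    using coprime_crossproduct_nat[OF nd(3) cop] by (simp add: mult.commute)
  moreover have "rep_lattice (n * d * c) c m3 = ?\<Lambda>"
    using C(2)[OF R] order_of_rep_lattice[OF nd(1,2) c nd(3), of m3] unfolding nd(4,5) by simp
  ultimately have "n = n1" "d = d1" "c = n2" "m3 = n4"
    using rep_lattice_order_inj[of "n * d" c m3 "n1 * d1" n2 n4] nd(1,2) c m3c pos by auto
  then show "C = eps_rel `` {rep_lattice (n1 * n2) (d1 * n2) n4}"
    using eps_classE(1)[OF C(1) R] unfolding nd(4,5) by simp
qed

lemma gcdQ_multiples:
  fixes m1 m2 :: nat
  assumes "m1 > 0" "m2 > 0" "e > 0"
  shows "gcdQ (of_nat m1 * e) (of_nat m2 * e) = of_nat (gcd m1 m2) * e"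
proof -
  let ?S = "{of_int x * (of_nat m1 * e) + of_int y * (of_nat m2 * e) | x y. True}"
  define c where "c = gcd m1 m2"
  have c: "of_nat c * e > 0" using assms by (simp add: c_def)
  have S: "?S = range (\<lambda>z. of_int z * (of_nat c * e))"
  proof (intro equalityI subsetI)
    fix t assume "t \<in> ?S"
    then obtain x y where t: "t = of_int x * (of_nat m1 * e) + of_int y * (of_nat m2 * e)" by blast
    obtain a b where "m1 = c * a" "m2 = c * b" unfolding c_def by (meson dvdE gcd_dvd1 gcd_dvd2)
    then have "t = of_int (x * int a + y * int b) * (of_nat c * e)"
      unfolding t by (simp add: algebra_simps)
    then show "t \<in> range (\<lambda>z. of_int z * (of_nat c * e))" by blast
  next
    fix t assume "t \<in> range (\<lambda>z. of_int z * (of_nat c * e))"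
    then obtain z where t: "t = of_int z * (of_nat c * e)" by blast
    obtain u v where uv: "u * int m1 + v * int m2 = int c"
      using bezout_int[of "int m1" "int m2"] by (auto simp: c_def)
    have "rat_of_nat c = of_int u * of_nat m1 + of_int v * of_nat m2"
      using arg_cong[OF uv, of rat_of_int] by simp
    then have "t = of_int (z * u) * (of_nat m1 * e) + of_int (z * v) * (of_nat m2 * e)"
      unfolding t by (simp add: algebra_simps)
    then show "t \<in> ?S" by blast
  qed
  show ?thesis
    unfolding gcdQ_def S c_def[symmetric]
  proof (rule the_equality)
    fix g assume g: "g > 0 \<and> range (\<lambda>z. of_int z * (of_nat c * e)) = range (\<lambda>z. of_int z * g)"
    have "1 * (of_nat c * e) \<in> range (\<lambda>z. of_int z * (of_nat c * e))" "1 * g \<in> range (\<lambda>z. of_int z * g)"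
      by (rule range_eqI[of _ _ 1], simp)+
    then have "\<exists>i. of_nat c * e = of_int i * g" "\<exists>j. g = of_int j * (of_nat c * e)"
      using g unfolding mult_1 by blast+
    then obtain i j where "of_nat c * e = of_int i * g" "g = of_int j * (of_nat c * e)" by blast
    then show "g = of_nat c * e" using pos_multiple_antisym[OF c conjunct1[OF g]] by metis
  qed (use c in simp)
qed

lemma shape_eq_tmat: "shape g h k = tmat 1 0 0 g h k"
  by (simp add: shape_def tmat_def)

text \<open>
  The common form of \<open>alpha_mat\<close> and \<open>gamma_mat\<close>.
\<close>

definition rep_shape :: "nat \<Rightarrow> nat \<Rightarrow> nat \<Rightarrow> rat mat" where
  "rep_shape m1 m2 m3 =
     shape (1 / of_nat m2) (of_nat m3 / (of_nat m1 * of_nat m2 ^ 2)) (1 / (of_nat m1 * of_nat m2))"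

lemma is_Zbasis_rep_shape_iff:
  "m1 > 0 \<Longrightarrow> m2 > 0 \<Longrightarrow> is_Zbasis (avec \<cdot>\<^sub>t rep_shape m1 m2 m3) L \<longleftrightarrow> L = rep_lattice m1 m2 m3"
  unfolding rep_shape_def shape_eq_tmat rep_lattice_def by (rule is_Zbasis_tmat_iff) auto

lemma gamma_mat_eq:
  "d1 > 0 \<Longrightarrow> gamma_mat d1 n2 (n1 * d1) n4 = rep_shape (n1 * n2) (d1 * n2) n4"
  unfolding gamma_mat_def rep_shape_def
  by (simp add: power2_eq_square power3_eq_cube ac_simps)

lemma alpha_mat_eq: "alpha_mat n2 n3 n4 = rep_shape (n3 * n2) n2 n4"
  unfolding alpha_mat_def rep_shape_def
  by (simp add: power2_eq_square power3_eq_cube ac_simps)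

lemma gcdQ_rep_shape:
  assumes "m1 > 0" "m2 > 0"
  shows "gcdQ ((1 / of_nat m2)\<^sup>2) (1 / (of_nat m1 * of_nat m2)) =
    of_nat (gcd m1 m2) / (of_nat m1 * of_nat m2 ^ 2)"
  using gcdQ_multiples[OF assms, of "1 / (of_nat m1 * of_nat m2 ^ 2)"] assms
  by (simp add: field_simps power2_eq_square)

lemma normal_form_rep_shape:
  assumes "m1 > 0" "m2 > 0" "m3 < gcd m1 m2"
  shows "normal_form (rep_shape m1 m2 m3)"
proof -
  let ?d = "rat_of_nat m1 * of_nat m2 ^ 2"
  have "?d > 0" using assms by simp
  then have "of_nat m3 / ?d < of_nat (gcd m1 m2) / ?d"
    using assms(3) by (intro divide_strict_right_mono) simp_all
  then show ?thesis
    unfolding normal_form_def rep_shape_def gcdQ_rep_shape[OF assms(1,2), symmetric]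
    by - (intro exI conjI, rule refl, use assms in auto)
qed

text \<open>
  A second normal form lattice in the class has the same \<open>g\<close> and \<open>k\<close>, and its \<open>h\<close> is again a
  multiple \<open>m' e\<close> of \<open>e = 1/(m\<^sub>1 m\<^sub>2\<^sup>2)\<close>. It is therefore itself of the form
  \<open>rep_lattice m1 m2 m'\<close> with \<open>m'\<close> in the same range as \<open>m\<^sub>3\<close>.
\<close>

lemma normal_form_rep_eq:
  assumes m: "m1 > 0" "m2 > 0" "m3 < gcd m1 m2"
  shows "normal_form_rep (eps_rel `` {rep_lattice m1 m2 m3}) = rep_lattice m1 m2 m3"
  unfolding normal_form_rep_def
proof (rule the_equality)
  let ?R = "rep_lattice m1 m2 m3"
  show "?R \<in> eps_rel `` {?R} \<and> (\<exists>\<gamma>. normal_form \<gamma> \<and> is_Zbasis (avec \<cdot>\<^sub>t \<gamma>) ?R)"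
    using eps_class_self(1)[OF full_lattice_rep_lattice[OF m(1,2)]] normal_form_rep_shape[OF m]
      is_Zbasis_rep_shape_iff[OF m(1,2)] by blast
next
  fix L assume "L \<in> eps_rel `` {rep_lattice m1 m2 m3} \<and> (\<exists>\<gamma>. normal_form \<gamma> \<and> is_Zbasis (avec \<cdot>\<^sub>t \<gamma>) L)"
  then obtain g h k where L: "(rep_lattice m1 m2 m3, L) \<in> eps_rel"
    and g: "g > 0" "k > 0" "0 \<le> h" "h < gcdQ (g\<^sup>2) k" and "is_Zbasis (avec \<cdot>\<^sub>t shape g h k) L"
    unfolding normal_form_def by auto
  then have Leq: "L = nlat g h k" by (simp add: shape_eq_tmat is_Zbasis_tmat_iff)
  let ?q = "of_nat :: nat \<Rightarrow> rat"
  have q: "?q m1 > 0" "?q m2 > 0" using m by simp_all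
  define e where "e = 1 / (?q m1 * ?q m2 ^ 2)"
  have e: "e > 0" using q by (simp add: e_def)
  obtain x y where gk: "g = 1 / ?q m2" "k = 1 / (?q m1 * ?q m2)"
    and h: "h = ?q m3 / (?q m1 * ?q m2 ^ 2) + of_int x * (1 / ?q m2)\<^sup>2 + of_int y * (1 / (?q m1 * ?q m2))"
    using L g q unfolding Leq rep_lattice_def by (subst (asm) nlat_eps_iff) auto
  define m where "m = int m3 + x * int m1 + y * int m2"
  have he: "h = of_int m * e"
    unfolding h e_def m_def using q by (simp add: field_simps power2_eq_square)
  then have "m \<ge> 0" using g(3) e by (simp add: zero_le_mult_iff)
  then obtain m' where m': "m = int m'" using zero_le_imp_eq_int by blast
  have "of_int m * e < ?q (gcd m1 m2) * e"
    using g(4) unfolding he gk gcdQ_rep_shape[OF assms(1,2)] by (simp add: e_def)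
  then have lt: "m' < gcd m1 m2" using e by (simp add: m')
  have L': "L = rep_lattice m1 m2 m'"
    unfolding Leq rep_lattice_def gk he m' e_def by simp
  have "m' = m3"
    using rep_lattice_eps_unique[OF assms(1,2,1,2,3) lt] L unfolding L' by blast
  then show "L = rep_lattice m1 m2 m3" using L' by simp
qed

section \<open>The matrix of multiplication by a\<close>

lemma rep_mat_index [simp]:
  "dim_row (rep_mat m1 m2 m3) = 3" "dim_col (rep_mat m1 m2 m3) = 3"
  "rep_mat m1 m2 m3 $$ (0,0) = 0" "rep_mat m1 m2 m3 $$ (0,Suc 0) = int m1" "rep_mat m1 m2 m3 $$ (0,2) = - int m3"
  "rep_mat m1 m2 m3 $$ (Suc 0,0) = 0" "rep_mat m1 m2 m3 $$ (Suc 0,Suc 0) = 0" "rep_mat m1 m2 m3 $$ (Suc 0,2) = int m2"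
  "rep_mat m1 m2 m3 $$ (2,0) = 0" "rep_mat m1 m2 m3 $$ (2,Suc 0) = 0" "rep_mat m1 m2 m3 $$ (2,2) = 0"
  by (simp_all add: rep_mat_def mat_of_rows_list_def)

lemma rep_mat_carrier [simp]: "rep_mat m1 m2 m3 \<in> carrier_mat 3 3"
  by (rule carrier_matI) simp_all

lemma mult_by_a_rep_mat_iff:
  "mult_by_a [x, y, z] (rep_mat m1 m2 m3) \<longleftrightarrow> gen_a * x = 0 \<and>
     gen_a * y = of_nat m1 *\<^sub>Q x \<and> gen_a * z = of_nat m2 *\<^sub>Q y - of_nat m3 *\<^sub>Q x"
  by (simp add: mult_by_a_def tuple_mult_def upt_3 sum_lessThan_3 nilalg_eq_iff)

text \<open>
  The order of the basis vectors is reversed so that \<open>a\<close> acts by an upper triangular matrix.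
\<close>

definition rep_basis :: "nat \<Rightarrow> nat \<Rightarrow> nat \<Rightarrow> nilalg list" where
  "rep_basis m1 m2 m3 = rev (avec \<cdot>\<^sub>t rep_shape m1 m2 m3)"

lemma rep_basis_eq:
  "rep_basis m1 m2 m3 = [Elt 0 0 (1 / (of_nat m1 * of_nat m2)),
     Elt 0 (1 / of_nat m2) (of_nat m3 / (of_nat m1 * of_nat m2 ^ 2)), 1]"
  by (simp add: rep_basis_def rep_shape_def shape_eq_tmat avec_tmat nilalg_eq_iff)

lemma is_Zbasis_rep_basis:
  "m1 > 0 \<Longrightarrow> m2 > 0 \<Longrightarrow> is_Zbasis (rep_basis m1 m2 m3) (rep_lattice m1 m2 m3)"
  using is_Zbasis_rep_shape_iff[of m1 m2 m3] by (simp add: rep_basis_def is_Zbasis_def)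

lemma mult_by_a_rep_basis:
  "m1 > 0 \<Longrightarrow> m2 > 0 \<Longrightarrow> mult_by_a (rep_basis m1 m2 m3) (rep_mat m1 m2 m3)"
  unfolding rep_basis_eq mult_by_a_rep_mat_iff
  by (simp add: nilalg_eq_iff field_simps power2_eq_square)

lemma mult_by_a_unique:
  assumes "is_Zbasis b L" "mult_by_a b M" "mult_by_a b M'"
  shows "M = M'"
  using assms mult_by_a_length[OF assms(2)] mult_by_a_length[OF assms(3)]
  by (intro Zbasis_coeff_unique[OF assms(1), of _ 3]) (auto simp: mult_by_a_def)

lemma zcomb_map_mult: "zcomb (map (\<lambda>x. u * x) b) c = u * zcomb b c"
  by (simp add: zcomb_def sum_distrib_left mult.left_commute)

lemma is_Zbasis_map_mult:
  assumes "is_Zbasis b L" "u dvd 1"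
  shows "is_Zbasis (map (\<lambda>x. u * x) b) ((\<lambda>x. u * x) ` L)"
proof -
  obtain v where v: "u * v = 1" using assms(2) by (metis dvdE)
  have "x = 0" if "u * x = 0" for x
    using v that by (metis mult.assoc mult.commute mult_1_left mult_zero_right)
  then show ?thesis
    using assms(1) unfolding is_Zbasis_iff_zcomb zcomb_map_mult by auto
qed

text \<open>
  Multiplication by a unit commutes with multiplication by \<open>a\<close>, so it carries bases to bases with
  the same matrix.
\<close>

lemma eps_rel_transport_basis:
  assumes "(L, L') \<in> eps_rel" "is_Zbasis b L" "mult_by_a b M"
  obtains b' where "is_Zbasis b' L'" "mult_by_a b' M"
proof -
  obtain u where u: "u dvd 1" "L' = (\<lambda>x. u * x) ` L"
    using assms(1) by (auto simp: eps_rel_def)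
  let ?b = "map (\<lambda>x. u * x) b"
  have len: "length b = 3" "M \<in> carrier_mat 3 3" using mult_by_a_length[OF assms(3)] by auto
  have "map (\<lambda>x. gen_a * x) ?b = map (\<lambda>x. u * x) (map (\<lambda>x. gen_a * x) b)"
    by (simp add: mult.left_commute)
  also have "\<dots> = ?b \<cdot>\<^sub>t map_mat rat_of_int M"
    using assms(3) len unfolding mult_by_a_def by (simp add: map_mult_tuple_mult)
  finally have "mult_by_a ?b M" using len by (simp add: mult_by_a_def)
  then show ?thesis using that is_Zbasis_map_mult[OF assms(2) u(1)] u(2) by blast
qed

text \<open>
  The last vector \<open>u\<close> of the basis determines the other two: since \<open>a\<^sup>2 u = m\<^sub>1 m\<^sub>2 x\<close> and
  \<open>a u = m\<^sub>2 y - m\<^sub>3 x\<close>, the whole basis is \<open>u\<close> times the basis \<open>rep_basis m1 m2 m3\<close>. If \<open>u\<close>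
  were not a unit, then \<open>a\<^sup>2 u\<close> and with it \<open>x\<close> would vanish.
\<close>

lemma rep_mat_determines_eps_class:
  assumes b: "is_Zbasis b L" "mult_by_a b (rep_mat m1 m2 m3)" and m: "m1 > 0" "m2 > 0"
  shows "(rep_lattice m1 m2 m3, L) \<in> eps_rel"
proof -
  let ?q = "of_nat :: nat \<Rightarrow> rat"
  have q: "?q m1 > 0" "?q m2 > 0" using m by simp_all
  obtain x y u where b3: "b = [x, y, u]"
    using mult_by_a_length[OF b(2)] by (auto simp: numeral_3_eq_3 length_Suc_conv)
  have e: "c0 x = 0" "c1 x = 0" "c0 y = 0" "c1 y = ?q m1 * c2 x" "c0 u = ?q m2 * c1 y"
    "c1 u = ?q m2 * c2 y - ?q m3 * c2 x"
    using b(2) q unfolding b3 mult_by_a_rep_mat_iff by (auto simp: nilalg_eq_iff)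
  have "c0 u \<noteq> 0"
  proof
    assume "c0 u = 0"
    then have "x = 0" using e q by (simp add: nilalg_eq_iff)
    then have "zcomb b (\<lambda>i. of_bool (i = 0)) = 0"
      unfolding b3 zcomb_def by (simp add: sum_lessThan_3 numeral_3_eq_3[symmetric])
    then show False using b(1) unfolding is_Zbasis_iff_zcomb b3 by force
  qed
  then have u: "u dvd 1" by (simp add: unit_iff)
  have "map (\<lambda>x. u * x) (rep_basis m1 m2 m3) = b"
    unfolding rep_basis_eq b3 using e q by (simp add: nilalg_eq_iff field_simps power2_eq_square)
  then have L: "L = (\<lambda>x. u * x) ` rep_lattice m1 m2 m3"
    using is_Zbasis_map_mult[OF is_Zbasis_rep_basis[OF m, of m3] u] b(1) by (simp add: is_Zbasis_def)
  have "full_lattice L"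
    unfolding L by (intro full_lattice_image_mult full_lattice_rep_lattice m) fact
  then show ?thesis
    using u L full_lattice_rep_lattice[OF m] by (auto simp: eps_rel_def)
qed

lemma Lambda_a_subset_order_of:
  assumes b: "is_Zbasis b L" "mult_by_a b M"
  shows "Lambda_a \<subseteq> order_of L"
proof -
  have len: "length b = 3" "M \<in> carrier_mat 3 3" using mult_by_a_length[OF b(2)] by auto
  have L: "L = Z.span (set b)" using b(1) by (simp add: is_Zbasis_def)
  have "gen_a * v \<in> L" if "v \<in> set b" for v
  proof -
    obtain j where j: "j < 3" "v = b ! j" using \<open>v \<in> set b\<close> len by (auto simp: in_set_conv_nth)
    have "gen_a * v = map (\<lambda>x. gen_a * x) b ! j" using j len by simp
    also have "\<dots> = zcomb b (\<lambda>i. M $$ (i,j))"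
      using b(2) j len tuple_mult_of_int_nth[of M b j] by (simp add: mult_by_a_def)
    also have "\<dots> \<in> L" using b(1) by (auto simp: is_Zbasis_iff_zcomb)
    finally show ?thesis .
  qed
  moreover have "Z.subspace {x. gen_a * x \<in> L}"
    unfolding L by (rule Z.subspaceI)
      (auto simp: Z.span_zero Z.span_add distrib_left mult.left_commute[of gen_a] intro: Z.span_scale)
  ultimately have aL: "gen_a * x \<in> L" if "x \<in> L" for x
    using Z.span_minimal[of "set b" "{x. gen_a * x \<in> L}"] that unfolding L[symmetric] by blast
  have "Z.subspace (order_of L)"
    unfolding order_of_def L by (rule Z.subspaceI)
      (auto simp: Z.span_zero Z.span_add distrib_right mult.assoc image_subset_iff intro: Z.span_scale)
  moreover have "{1, gen_a, gen_a ^ 2} \<subseteq> order_of L"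
    using aL by (auto simp: order_of_def power2_eq_square mult.assoc)
  ultimately show ?thesis unfolding Lambda_a_def by (intro Z.span_minimal)
qed

text \<open>
  All bases of all lattices of the class can be carried by units to one lattice, where conjugation
  over the integers and change of basis are the same.
\<close>

lemma class_matrices_eq:
  assumes C: "C \<in> eps_classes" "L \<in> C" and b: "is_Zbasis b L" "mult_by_a b M"
  shows "class_matrices C = conj_class M"
proof (intro equalityI subsetI)
  fix N assume "N \<in> class_matrices C"
  then obtain L' b' where b': "L' \<in> C" "is_Zbasis b' L'" "mult_by_a b' N"
    by (auto simp: class_matrices_def)
  have "(L', L) \<in> eps_rel" using eps_classE(1)[OF C(1) b'(1)] C(2) by blast
  then obtain b'' where "is_Zbasis b'' L" "mult_by_a b'' N"
    using eps_rel_transport_basis b'(2,3) by metis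
  then show "N \<in> conj_class M"
    using change_of_basis_similar[OF b] by (simp add: conj_class_def)
next
  fix N assume "N \<in> conj_class M"
  then show "N \<in> class_matrices C"
    using similar_change_of_basis[OF b] C(2) unfolding class_matrices_def conj_class_def by blast
qed

lemma sum_atLeast0_3: "(\<Sum>i = 0..<(3::nat). f i) = f 0 + f 1 + f 2"
  by (simp add: numeral_3_eq_3 numeral_2_eq_2)

lemma jordan_matrix_single: "jordan_matrix [(n, x)] = jordan_block n x"
  by (simp only: jordan_matrix_def list.map prod.case diag_block_mat_singleton)

text \<open>
  The chain \<open>e\<^sub>3\<close>, \<open>M e\<^sub>3\<close>, \<open>M\<^sup>2 e\<^sub>3\<close>, read backwards, is a rational Jordan basis: these vectors are the
  columns of the matrix \<open>?P\<close> below.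
\<close>

lemma rep_mat_single_block:
  assumes m: "m1 > 0" "m2 > 0"
  shows "rep_mat m1 m2 m3 \<in> nilp_single_block"
proof -
  let ?M = "rep_mat m1 m2 m3" and ?q = "of_nat :: nat \<Rightarrow> rat"
  have q: "?q m1 > 0" "?q m2 > 0" using m by simp_all
  have "?M ^\<^sub>m Suc (Suc (Suc 0)) = ?M * ?M * ?M"
    by (simp add: left_mult_one_mat[OF rep_mat_carrier])
  also have "\<dots> = 0\<^sub>m 3 3"
    by (rule eq_matI) (auto simp: less_3_iff scalar_prod_def sum_atLeast0_3)
  finally have "\<exists>k. ?M ^\<^sub>m k = 0\<^sub>m 3 3" by blast
  moreover have "similar_mat (map_mat rat_of_int ?M) (jordan_block 3 0)"
  proof (rule similar_matI)
    let ?P = "mat 3 3 (\<lambda>(i,j). [[?q m1 * ?q m2, - ?q m3, 0], [0, ?q m2, 0], [0, 0, 1]] ! i ! j)"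
    let ?Q = "mat 3 3 (\<lambda>(i,j).
      [[1 / (?q m1 * ?q m2), ?q m3 / (?q m1 * ?q m2 ^ 2), 0], [0, 1 / ?q m2, 0], [0, 0, 1]] ! i ! j)"
    show "{map_mat rat_of_int ?M, jordan_block 3 0, ?P, ?Q} \<subseteq> carrier_mat 3 3"
      by simp
    show "?P * ?Q = 1\<^sub>m 3" "?Q * ?P = 1\<^sub>m 3"
      by (rule eq_matI; use q in \<open>auto simp: less_3_iff scalar_prod_def
          sum_atLeast0_3 field_simps power2_eq_square\<close>)+
    show "map_mat rat_of_int ?M = ?P * jordan_block 3 0 * ?Q"
      by (rule eq_matI; use q in \<open>auto simp: less_3_iff
          scalar_prod_def sum_atLeast0_3 field_simps power2_eq_square\<close>)
  qed
  then have "jordan_nf (map_mat rat_of_int ?M) [(3, 0)]"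
    by (simp add: jordan_nf_def jordan_matrix_single)
  ultimately show ?thesis unfolding nilp_single_block_def by auto
qed

text \<open>
  Let \<open>N = P J R\<close> with \<open>R = P\<inverse>\<close> and the Jordan block \<open>J\<close>. The block \<open>J\<close> is the matrix of \<open>a\<close> with
  respect to \<open>v = (a\<^sup>2, a, 1)\<close>, and therefore \<open>N = R\<inverse> J R\<close> is its matrix with respect to the basis
  \<open>v \<cdot> R\<close>, whose integer span is the required lattice.
\<close>

lemma single_block_lattice:
  assumes N: "N \<in> nilp_single_block"
  obtains b L where "full_lattice L" "is_Zbasis b L" "mult_by_a b N"
proof -
  let ?h = "map_mat rat_of_int"
  obtain k ev where car: "N \<in> carrier_mat 3 3" and pow: "N ^\<^sub>m k = 0\<^sub>m 3 3"
    and jnf: "jordan_nf (?h N) [(3, ev)]"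
    using N unfolding nilp_single_block_def by auto
  let ?J = "jordan_block 3 ev"
  obtain P R where wit: "similar_mat_wit (?h N) ?J P R"
    using jnf unfolding jordan_nf_def similar_mat_def jordan_matrix_single by blast
  have hN: "?h N \<in> carrier_mat 3 3" using car by simp
  note w = similar_mat_witD2[OF hN wit]
  have "?J ^\<^sub>m k = R * (?h N) ^\<^sub>m k * P"
    by (rule similar_mat_wit_pow_id[OF similar_mat_wit_sym[OF wit]])
  also have "(?h N) ^\<^sub>m k = 0\<^sub>m 3 3"
    unfolding of_int_hom.mat_hom_pow[OF car, of k, symmetric] pow by (rule eq_matI) auto
  finally have "?J ^\<^sub>m k = 0\<^sub>m 3 3" using w by simp
  \<comment> \<open>A power of the block has the same power of the eigenvalue on its diagonal.\<close>
  then have "(?J ^\<^sub>m k) $$ (0,0) = 0" by simp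
  then have ev: "ev = 0" by (simp add: jordan_block_pow)
  define v where "v = [gen_a ^ 2, gen_a, 1]"
  have lenv: "length v = 3" by (simp add: v_def)
  have av: "map (\<lambda>x. gen_a * x) v = v \<cdot>\<^sub>t ?J"
    unfolding ev v_def gen_a_power2
    by (simp add: tuple_mult_def upt_3 sum_lessThan_3 nilalg_eq_iff)
  define b where "b = v \<cdot>\<^sub>t R"
  have lenb: "length b = 3" using w by (simp add: b_def)
  have vb: "v = b \<cdot>\<^sub>t P"
    unfolding b_def using w lenv by (subst tuple_mult_assoc) (auto simp: tuple_mult_one)
  have "R * ?h N = R * (P * (?J * R))"
    unfolding w(3) using w(5-7) by (simp add: assoc_mult_mat[of P 3 3 ?J 3 R 3])
  also have "\<dots> = R * P * (?J * R)"
    by (rule assoc_mult_mat[symmetric]) (use w(5-7) in auto)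
  also have "\<dots> = ?J * R" using w(2,5,7) by simp
  finally have RN: "R * ?h N = ?J * R" .
  have "map (\<lambda>x. gen_a * x) b = (v \<cdot>\<^sub>t ?J) \<cdot>\<^sub>t R"
    unfolding b_def using w lenv by (subst map_mult_tuple_mult) (auto simp: av)
  also have "\<dots> = b \<cdot>\<^sub>t ?h N"
    unfolding b_def using w RN car by (simp add: tuple_mult_assoc)
  finally have mult: "mult_by_a b N" using car by (simp add: mult_by_a_def)
  define L where "L = range (zcomb b)"
  have "c i = 0" if c: "zcomb b c = 0" "i < 3" for c i
  proof -
    let ?c = "mat 3 1 (\<lambda>(i,j). rat_of_int (c i))"
    have cc: "?c \<in> carrier_mat 3 1" by simp
    have "v \<cdot>\<^sub>t (R * ?c) = b \<cdot>\<^sub>t ?c"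
      unfolding b_def using w by (simp add: tuple_mult_assoc)
    also have "\<dots> = [0]"
      using c(1) lenb by (intro nth_equalityI) (simp_all add: zcomb_scaleQ)
    finally have "(v \<cdot>\<^sub>t (R * ?c)) ! 0 = 0" by simp
    then have "(\<Sum>i<3. (R * ?c) $$ (i,0) *\<^sub>Q v ! i) = 0"
      using w by (subst (asm) nth_tuple_mult) auto
    then have "\<forall>i<3. (R * ?c) $$ (i,0) = 0"
      unfolding sum_lessThan_3 less_3_iff v_def gen_a_power2 by (auto simp: nilalg_eq_iff)
    then have "R * ?c = 0\<^sub>m 3 1" using w by (intro eq_matI) auto
    then have "P * (R * ?c) = 0\<^sub>m 3 1" using w by simp
    then have "?c = 0\<^sub>m 3 1"
      using w(1,6,7) cc by (subst (asm) assoc_mult_mat[of P 3 3 R 3 ?c 1, symmetric]) auto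
    then have "?c $$ (i,0) = (0\<^sub>m 3 1 :: rat mat) $$ (i,0)" by simp
    then show ?thesis using c(2) by simp
  qed
  then have bL: "is_Zbasis b L" by (simp add: is_Zbasis_iff_zcomb lenb L_def)
  have "Q.span L = UNIV"
  proof -
    have "b ! i \<in> Q.span L" if "i < 3" for i
      using Zbasis_subset[OF bL] that lenb by (intro Q.span_base) auto
    then have "v ! j \<in> Q.span L" if "j < 3" for j
      using that w by (subst vb) (auto intro!: Q.span_sum Q.span_scale)
    then have v: "gen_a ^ 2 \<in> Q.span L" "gen_a \<in> Q.span L" "1 \<in> Q.span L"
      by (force simp: v_def less_3_iff)+
    have "x \<in> Q.span L" for x
      using v by (cases x) (auto simp: Elt_conv_gen_a intro!: Q.span_add Q.span_scale)
    then show ?thesis by blast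
  qed
  then have "full_lattice L"
    using bL unfolding full_lattice_def is_Zbasis_def by blast
  then show ?thesis using that bL mult by blast
qed

lemma single_block_similar_rep_mat:
  assumes "N \<in> nilp_single_block"
  obtains m1 m2 m3 where "m1 > 0" "m2 > 0" "m3 < gcd m1 m2" "similar_mat N (rep_mat m1 m2 m3)"
proof -
  obtain b L where b: "full_lattice L" "is_Zbasis b L" "mult_by_a b N"
    using single_block_lattice[OF assms] by metis
  obtain m1 m2 m3 where m: "m1 > 0" "m2 > 0" "m3 < gcd m1 m2" "(L, rep_lattice m1 m2 m3) \<in> eps_rel"
    using full_lattice_eps_rep_lattice[OF b(1) Lambda_a_subset_order_of[OF b(2,3)]] by metis
  obtain b' where "is_Zbasis b' (rep_lattice m1 m2 m3)" "mult_by_a b' N"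
    using eps_rel_transport_basis[OF m(4) b(2,3)] by metis
  then have "similar_mat N (rep_mat m1 m2 m3)"
    using change_of_basis_similar is_Zbasis_rep_basis[OF m(1,2)] mult_by_a_rep_basis[OF m(1,2)] by blast
  then show ?thesis using that m by blast
qed

text \<open>
  Conjugate matrices belong to bases of one lattice, and by \<open>rep_mat_determines_eps_class\<close> that
  lattice is \<open>\<epsilon>\<close>-equivalent to both representatives.
\<close>

lemma rep_mat_similar_unique:
  assumes m: "m1 > 0" "m2 > 0" "m3 < gcd m1 m2" and m': "m1' > 0" "m2' > 0" "m3' < gcd m1' m2'"
    and sim: "similar_mat (rep_mat m1 m2 m3) (rep_mat m1' m2' m3')"
  shows "m1' = m1 \<and> m2' = m2 \<and> m3' = m3"
proof -
  obtain b where "is_Zbasis b (rep_lattice m1' m2' m3')" "mult_by_a b (rep_mat m1 m2 m3)"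
    using similar_change_of_basis[OF is_Zbasis_rep_basis[OF m'(1,2)] mult_by_a_rep_basis[OF m'(1,2)] sim]
    by blast
  then have "(rep_lattice m1 m2 m3, rep_lattice m1' m2' m3') \<in> eps_rel"
    using rep_mat_determines_eps_class m(1,2) by blast
  then show ?thesis using rep_lattice_eps_unique m m' by blast
qed

text \<open>
  If the matrices of \<open>C\<close> form the conjugacy class of \<open>rep_mat m1 m2 m3\<close>, then this matrix itself
  belongs to some basis of some lattice of \<open>C\<close>, and this determines \<open>C\<close>.
\<close>

lemma corresponds_rep_mat_iff:
  assumes m: "m1 > 0" "m2 > 0"
  shows "corresponds C (rep_mat m1 m2 m3) \<longleftrightarrow> C = eps_rel `` {rep_lattice m1 m2 m3}"
proof
  let ?R = "rep_lattice m1 m2 m3" and ?M = "rep_mat m1 m2 m3"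
  note b = is_Zbasis_rep_basis[OF m, of m3] mult_by_a_rep_basis[OF m, of m3]
  assume C: "C = eps_rel `` {?R}"
  have cls: "C \<in> eps_classes" "?R \<in> C"
    unfolding C by (intro eps_class_self full_lattice_rep_lattice m)+
  moreover have "Lambda_a \<subseteq> order_of L" if "L \<in> C" for L
    using Lambda_a_subset_order_of[OF b] order_of_eps_invariant[of ?R L] that unfolding C by auto
  ultimately show "corresponds C ?M"
    using class_matrices_eq[OF cls b] unfolding corresponds_def by blast
next
  let ?M = "rep_mat m1 m2 m3"
  assume "corresponds C ?M"
  then have C: "C \<in> eps_classes" "class_matrices C = conj_class ?M"
    by (auto simp: corresponds_def)
  have "?M \<in> conj_class ?M"
    by (simp add: conj_class_def similar_mat_refl[OF rep_mat_carrier])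
  then obtain L b where L: "L \<in> C" "is_Zbasis b L" "mult_by_a b ?M"
    unfolding C(2)[symmetric] by (auto simp: class_matrices_def)
  have "(rep_lattice m1 m2 m3, L) \<in> eps_rel"
    by (rule rep_mat_determines_eps_class[OF L(2,3) m])
  then show "C = eps_rel `` {rep_lattice m1 m2 m3}"
    using eps_classE(1)[OF C(1) L(1)] equiv_class_eq[OF equiv_eps_rel] by simp
qed

section \<open>Orders, classes and matrices in one list of parameters\<close>

lemma is_Zbasis_alpha_iff:
  "n2 > 0 \<Longrightarrow> n3 > 0 \<Longrightarrow>
    is_Zbasis (avec \<cdot>\<^sub>t alpha_mat n2 n3 n4) \<Lambda> \<longleftrightarrow> \<Lambda> = rep_lattice (n3 * n2) n2 n4"
  unfolding alpha_mat_eq by (rule is_Zbasis_rep_shape_iff) auto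

lemma Delta_alpha:
  assumes "n2 > 0" "n3 > 0" "is_Zbasis (avec \<cdot>\<^sub>t alpha_mat n2 n3 n4) \<Lambda>"
  shows "Delta \<Lambda> = of_nat n3"
  using assms by (simp add: is_Zbasis_alpha_iff Delta_rep_lattice)

lemma order_alpha_basis:
  assumes "is_order \<Lambda>" "Lambda_a \<subseteq> \<Lambda>"
  shows "\<exists>!b. is_Zbasis b \<Lambda> \<and>
    (\<exists>n2 n3 n4. n2 > 0 \<and> n3 > 0 \<and> n4 < n2 \<and> b = avec \<cdot>\<^sub>t alpha_mat n2 n3 n4)"
proof -
  obtain n2 n3 n4 where n: "n2 > 0" "n3 > 0" "n4 < n2" and \<Lambda>: "\<Lambda> = rep_lattice (n3 * n2) n2 n4"
    using order_containing_a_eq_rep_lattice[OF assms] by metis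
  show ?thesis
  proof (rule ex1I[of _ "avec \<cdot>\<^sub>t alpha_mat n2 n3 n4"])
    show "is_Zbasis (avec \<cdot>\<^sub>t alpha_mat n2 n3 n4) \<Lambda> \<and> (\<exists>n2' n3' n4'. n2' > 0 \<and> n3' > 0 \<and> n4' < n2' \<and>
        avec \<cdot>\<^sub>t alpha_mat n2 n3 n4 = avec \<cdot>\<^sub>t alpha_mat n2' n3' n4')"
      using n is_Zbasis_alpha_iff[OF n(1,2)] \<Lambda> by blast
  next
    fix b assume b: "is_Zbasis b \<Lambda> \<and>
      (\<exists>n2 n3 n4. n2 > 0 \<and> n3 > 0 \<and> n4 < n2 \<and> b = avec \<cdot>\<^sub>t alpha_mat n2 n3 n4)"
    then obtain n2' n3' n4' where n': "n2' > 0" "n3' > 0" "n4' < n2'"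
      and b': "b = avec \<cdot>\<^sub>t alpha_mat n2' n3' n4'" by blast
    have "rep_lattice (n3 * n2) n2 n4 = rep_lattice (n3' * n2') n2' n4'"
      using b is_Zbasis_alpha_iff[OF n'(1,2)] unfolding b' \<Lambda> by blast
    then show "b = avec \<cdot>\<^sub>t alpha_mat n2 n3 n4"
      using rep_lattice_order_inj[of n3 n2 n4 n3' n2' n4'] n n' b' by simp
  qed
qed

lemma rep_mats_classify_single_blocks:
  assumes "N \<in> nilp_single_block"
  shows "\<exists>!M. M \<in> rep_mats \<and> N \<in> conj_class M"
proof -
  obtain m1 m2 m3 where m: "m1 > 0" "m2 > 0" "m3 < gcd m1 m2" and N: "similar_mat N (rep_mat m1 m2 m3)"
    using single_block_similar_rep_mat[OF assms] by metis
  show ?thesis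
  proof (rule ex1I[of _ "rep_mat m1 m2 m3"])
    show "rep_mat m1 m2 m3 \<in> rep_mats \<and> N \<in> conj_class (rep_mat m1 m2 m3)"
      using m N unfolding rep_mats_def conj_class_def by blast
  next
    fix M assume M: "M \<in> rep_mats \<and> N \<in> conj_class M"
    then obtain m1' m2' m3' where m': "m1' > 0" "m2' > 0" "m3' < gcd m1' m2'"
      and M': "M = rep_mat m1' m2' m3'" unfolding rep_mats_def by blast
    have "similar_mat (rep_mat m1 m2 m3) (rep_mat m1' m2' m3')"
      using M N similar_mat_trans[OF similar_mat_sym[OF N]] unfolding M' conj_class_def by blast
    from rep_mat_similar_unique[OF m m' this] show "M = rep_mat m1 m2 m3" unfolding M' by simp
  qed
qed

lemma class_with_pair_unique:
  assumes "class_with \<Lambda> (of_nat n / of_nat d) C" "class_with \<Lambda> (of_nat n1 / of_nat d1) C"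
    and "d > 0" "d1 > 0" "coprime n d" "coprime n1 d1"
  shows "n1 = n \<and> d1 = d"
proof -
  have "rat_of_nat n1 / of_nat d1 = of_nat n / of_nat d"
    using assms(1,2) by (simp add: class_with_def)
  then have "rat_of_nat (n1 * d) = of_nat (n * d1)"
    using assms(3,4) by (simp add: field_simps)
  then have "n1 * d = n * d1" unfolding of_nat_eq_iff .
  then show ?thesis
    using coprime_crossproduct_nat[OF assms(6,5)] by (simp add: mult.commute)
qed

theorem theorem10p7:
  shows
   "\<comment> \<open>(a)\<close>
    (\<forall>\<Lambda>. is_order \<Lambda> \<and> Lambda_a \<subseteq> \<Lambda> \<longrightarrow>
       (\<exists>!b. is_Zbasis b \<Lambda> \<and>
          (\<exists>n2 n3 n4. n2 > 0 \<and> n3 > 0 \<and> n4 < n2 \<and> b = avec \<cdot>\<^sub>t alpha_mat n2 n3 n4)) \<and>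
       (\<forall>n2 n3 n4. n2 > 0 \<and> n3 > 0 \<and> n4 < n2 \<and> is_Zbasis (avec \<cdot>\<^sub>t alpha_mat n2 n3 n4) \<Lambda> \<longrightarrow>
          Delta \<Lambda> = of_nat n3)) \<and>
    \<comment> \<open>(b)\<close>
    (\<forall>\<Lambda> n2 n3 n4 n1 d1.
       is_order \<Lambda> \<and> Lambda_a \<subseteq> \<Lambda> \<and>
       n2 > 0 \<and> n3 > 0 \<and> n4 < n2 \<and> is_Zbasis (avec \<cdot>\<^sub>t alpha_mat n2 n3 n4) \<Lambda> \<and>
       n1 > 0 \<and> d1 > 0 \<and> n3 = n1 * d1 \<and> coprime n1 d1 \<longrightarrow>
       (\<exists>!C. class_with \<Lambda> (of_nat n1 / of_nat d1) C) \<and>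
       (\<forall>C. class_with \<Lambda> (of_nat n1 / of_nat d1) C \<longrightarrow>
          normal_form_rep C \<in> C \<and>
          normal_form (gamma_mat d1 n2 n3 n4) \<and>
          is_Zbasis (avec \<cdot>\<^sub>t gamma_mat d1 n2 n3 n4) (normal_form_rep C))) \<and>
    \<comment> \<open>(c)\<close>
    (\<forall>n2 n3 n4 n1 d1.
       n2 > 0 \<and> n3 > 0 \<and> n4 < n2 \<and> n1 > 0 \<and> d1 > 0 \<and> n3 = n1 * d1 \<and> coprime n1 d1 \<longrightarrow>
       (\<forall>M. mult_by_a (rev (avec \<cdot>\<^sub>t gamma_mat d1 n2 n3 n4)) M \<longleftrightarrow>
          M = rep_mat (n1 * n2) (d1 * n2) n4) \<and>
       rep_mat (n1 * n2) (d1 * n2) n4 \<in> nilp_single_block \<and>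
       (\<exists>!\<Lambda>. is_order \<Lambda> \<and> Lambda_a \<subseteq> \<Lambda> \<and> is_Zbasis (avec \<cdot>\<^sub>t alpha_mat n2 n3 n4) \<Lambda>) \<and>
       (\<forall>\<Lambda>. is_order \<Lambda> \<and> Lambda_a \<subseteq> \<Lambda> \<and> is_Zbasis (avec \<cdot>\<^sub>t alpha_mat n2 n3 n4) \<Lambda> \<longrightarrow>
          Delta \<Lambda> = of_nat n3 \<and>
          (\<exists>!C. class_with \<Lambda> (of_nat n1 / of_nat d1) C))) \<and>
    \<comment> \<open>(d)\<close>
    rep_mats \<subseteq> nilp_single_block \<and>
    (\<forall>N\<in>nilp_single_block. \<exists>!M. M \<in> rep_mats \<and> N \<in> conj_class M) \<and>
    (\<forall>m1 m2 m3 n2 n3 n4.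
       m1 > 0 \<and> m2 > 0 \<and> m3 < gcd m1 m2 \<and>
       n2 = gcd m1 m2 \<and> n3 = m1 * m2 div n2\<^sup>2 \<and> n4 = m3 \<longrightarrow>
       (\<exists>!C. corresponds C (rep_mat m1 m2 m3)) \<and>
       (\<forall>C. corresponds C (rep_mat m1 m2 m3) \<longrightarrow>
          (\<forall>L\<in>C. is_order (order_of L) \<and> Lambda_a \<subseteq> order_of L \<and>
             is_Zbasis (avec \<cdot>\<^sub>t alpha_mat n2 n3 n4) (order_of L) \<and>
             (\<forall>n1 d1. n1 > 0 \<and> d1 > 0 \<and> coprime n1 d1 \<and> n3 = n1 * d1 \<and>
                  class_with (order_of L) (of_nat n1 / of_nat d1) C \<longleftrightarrow>
                n1 = m1 div n2 \<and> d1 = m2 div n2))))"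
proof (intro conjI)
  show "\<forall>\<Lambda>. is_order \<Lambda> \<and> Lambda_a \<subseteq> \<Lambda> \<longrightarrow>
       (\<exists>!b. is_Zbasis b \<Lambda> \<and>
          (\<exists>n2 n3 n4. n2 > 0 \<and> n3 > 0 \<and> n4 < n2 \<and> b = avec \<cdot>\<^sub>t alpha_mat n2 n3 n4)) \<and>
       (\<forall>n2 n3 n4. n2 > 0 \<and> n3 > 0 \<and> n4 < n2 \<and> is_Zbasis (avec \<cdot>\<^sub>t alpha_mat n2 n3 n4) \<Lambda> \<longrightarrow>
          Delta \<Lambda> = of_nat n3)"
    by (intro allI impI conjI; elim conjE; rule order_alpha_basis Delta_alpha; assumption)

  have b: "(\<exists>!C. class_with \<Lambda> (of_nat n1 / of_nat d1) C) \<and>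
       (\<forall>C. class_with \<Lambda> (of_nat n1 / of_nat d1) C \<longrightarrow>
          normal_form_rep C \<in> C \<and>
          normal_form (gamma_mat d1 n2 n3 n4) \<and>
          is_Zbasis (avec \<cdot>\<^sub>t gamma_mat d1 n2 n3 n4) (normal_form_rep C))"
    if n: "n2 > 0" "n4 < n2" "n1 > 0" "d1 > 0" "n3 = n1 * d1" "coprime n1 d1"
      and \<Lambda>: "is_Zbasis (avec \<cdot>\<^sub>t alpha_mat n2 n3 n4) \<Lambda>"
    for \<Lambda> n2 n3 n4 n1 d1
  proof -
    let ?R = "rep_lattice (n1 * n2) (d1 * n2) n4"
    have n3: "n1 * d1 > 0" using n by simp
    have "\<Lambda> = rep_lattice (n1 * d1 * n2) n2 n4"
      using \<Lambda> unfolding n(5) is_Zbasis_alpha_iff[OF n(1) n3] .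
    then have C: "class_with \<Lambda> (of_nat n1 / of_nat d1) C \<longleftrightarrow> C = eps_rel `` {?R}" for C
      using class_with_iff[OF n(3,4,1,2,6)] by blast
    have m: "n1 * n2 > 0" "d1 * n2 > 0" using n by simp_all
    have m3: "n4 < gcd (n1 * n2) (d1 * n2)"
      using n(2,6) gcd_mult_distrib_nat[of n2 n1 d1]
      by (simp add: mult.commute coprime_iff_gcd_eq_1)
    have "?R \<in> eps_rel `` {?R}" by (intro eps_class_self full_lattice_rep_lattice m)
    moreover have "is_Zbasis (avec \<cdot>\<^sub>t gamma_mat d1 n2 n3 n4) ?R"
      unfolding n(5) gamma_mat_eq[OF n(4)] is_Zbasis_rep_shape_iff[OF m] ..
    moreover have "normal_form (gamma_mat d1 n2 n3 n4)"
      unfolding n(5) gamma_mat_eq[OF n(4)] by (rule normal_form_rep_shape[OF m m3])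
    ultimately show ?thesis
      unfolding C using normal_form_rep_eq[OF m m3] by auto
  qed
  show "\<forall>\<Lambda> n2 n3 n4 n1 d1.
       is_order \<Lambda> \<and> Lambda_a \<subseteq> \<Lambda> \<and>
       n2 > 0 \<and> n3 > 0 \<and> n4 < n2 \<and> is_Zbasis (avec \<cdot>\<^sub>t alpha_mat n2 n3 n4) \<Lambda> \<and>
       n1 > 0 \<and> d1 > 0 \<and> n3 = n1 * d1 \<and> coprime n1 d1 \<longrightarrow>
       (\<exists>!C. class_with \<Lambda> (of_nat n1 / of_nat d1) C) \<and>
       (\<forall>C. class_with \<Lambda> (of_nat n1 / of_nat d1) C \<longrightarrow>
          normal_form_rep C \<in> C \<and>
          normal_form (gamma_mat d1 n2 n3 n4) \<and>
          is_Zbasis (avec \<cdot>\<^sub>t gamma_mat d1 n2 n3 n4) (normal_form_rep C))"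
    by (intro allI impI, elim conjE, rule b)

  show "\<forall>n2 n3 n4 n1 d1.
       n2 > 0 \<and> n3 > 0 \<and> n4 < n2 \<and> n1 > 0 \<and> d1 > 0 \<and> n3 = n1 * d1 \<and> coprime n1 d1 \<longrightarrow>
       (\<forall>M. mult_by_a (rev (avec \<cdot>\<^sub>t gamma_mat d1 n2 n3 n4)) M \<longleftrightarrow>
          M = rep_mat (n1 * n2) (d1 * n2) n4) \<and>
       rep_mat (n1 * n2) (d1 * n2) n4 \<in> nilp_single_block \<and>
       (\<exists>!\<Lambda>. is_order \<Lambda> \<and> Lambda_a \<subseteq> \<Lambda> \<and> is_Zbasis (avec \<cdot>\<^sub>t alpha_mat n2 n3 n4) \<Lambda>) \<and>
       (\<forall>\<Lambda>. is_order \<Lambda> \<and> Lambda_a \<subseteq> \<Lambda> \<and> is_Zbasis (avec \<cdot>\<^sub>t alpha_mat n2 n3 n4) \<Lambda> \<longrightarrow>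
          Delta \<Lambda> = of_nat n3 \<and>
          (\<exists>!C. class_with \<Lambda> (of_nat n1 / of_nat d1) C))"
  proof (intro allI impI)
    fix n2 n3 n4 n1 d1 :: nat
    assume "n2 > 0 \<and> n3 > 0 \<and> n4 < n2 \<and> n1 > 0 \<and> d1 > 0 \<and> n3 = n1 * d1 \<and> coprime n1 d1"
    then have n: "n2 > 0" "n3 > 0" "n4 < n2" "n1 > 0" "d1 > 0" "n3 = n1 * d1" "coprime n1 d1" by auto
    have m: "n1 * n2 > 0" "d1 * n2 > 0" using n by simp_all
    let ?M = "rep_mat (n1 * n2) (d1 * n2) n4"
    have rb: "rev (avec \<cdot>\<^sub>t gamma_mat d1 n2 n3 n4) = rep_basis (n1 * n2) (d1 * n2) n4"
      unfolding rep_basis_def n(6) gamma_mat_eq[OF n(5)] ..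
    show "(\<forall>M. mult_by_a (rev (avec \<cdot>\<^sub>t gamma_mat d1 n2 n3 n4)) M \<longleftrightarrow> M = ?M) \<and>
       ?M \<in> nilp_single_block \<and>
       (\<exists>!\<Lambda>. is_order \<Lambda> \<and> Lambda_a \<subseteq> \<Lambda> \<and> is_Zbasis (avec \<cdot>\<^sub>t alpha_mat n2 n3 n4) \<Lambda>) \<and>
       (\<forall>\<Lambda>. is_order \<Lambda> \<and> Lambda_a \<subseteq> \<Lambda> \<and> is_Zbasis (avec \<cdot>\<^sub>t alpha_mat n2 n3 n4) \<Lambda> \<longrightarrow>
          Delta \<Lambda> = of_nat n3 \<and>
          (\<exists>!C. class_with \<Lambda> (of_nat n1 / of_nat d1) C))"
    proof (intro conjI)
      show "\<forall>M. mult_by_a (rev (avec \<cdot>\<^sub>t gamma_mat d1 n2 n3 n4)) M \<longleftrightarrow> M = ?M"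
        unfolding rb
        using mult_by_a_unique[OF is_Zbasis_rep_basis[OF m] _ mult_by_a_rep_basis[OF m]]
          mult_by_a_rep_basis[OF m] by metis
      show "?M \<in> nilp_single_block" by (rule rep_mat_single_block[OF m])
      have "is_order (rep_lattice (n3 * n2) n2 n4)" "Lambda_a \<subseteq> rep_lattice (n3 * n2) n2 n4"
        by (rule is_order_rep_lattice[OF n(2,1)], rule Lambda_a_subset_rep_lattice[OF n(2,1)])
      then show "\<exists>!\<Lambda>. is_order \<Lambda> \<and> Lambda_a \<subseteq> \<Lambda> \<and> is_Zbasis (avec \<cdot>\<^sub>t alpha_mat n2 n3 n4) \<Lambda>"
        unfolding is_Zbasis_alpha_iff[OF n(1,2)] by metis
      show "\<forall>\<Lambda>. is_order \<Lambda> \<and> Lambda_a \<subseteq> \<Lambda> \<and> is_Zbasis (avec \<cdot>\<^sub>t alpha_mat n2 n3 n4) \<Lambda> \<longrightarrow>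
          Delta \<Lambda> = of_nat n3 \<and> (\<exists>!C. class_with \<Lambda> (of_nat n1 / of_nat d1) C)"
        by (intro allI impI, elim conjE)
           (rule conjI[OF Delta_alpha[OF n(1,2)] b[OF n(1,3,4,5,6,7), THEN conjunct1]])
    qed
  qed

  show "rep_mats \<subseteq> nilp_single_block"
    unfolding rep_mats_def using rep_mat_single_block by blast
  show "\<forall>N\<in>nilp_single_block. \<exists>!M. M \<in> rep_mats \<and> N \<in> conj_class M"
    using rep_mats_classify_single_blocks by blast

  show "\<forall>m1 m2 m3 n2 n3 n4.
       m1 > 0 \<and> m2 > 0 \<and> m3 < gcd m1 m2 \<and>
       n2 = gcd m1 m2 \<and> n3 = m1 * m2 div n2\<^sup>2 \<and> n4 = m3 \<longrightarrow>
       (\<exists>!C. corresponds C (rep_mat m1 m2 m3)) \<and>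
       (\<forall>C. corresponds C (rep_mat m1 m2 m3) \<longrightarrow>
          (\<forall>L\<in>C. is_order (order_of L) \<and> Lambda_a \<subseteq> order_of L \<and>
             is_Zbasis (avec \<cdot>\<^sub>t alpha_mat n2 n3 n4) (order_of L) \<and>
             (\<forall>n1 d1. n1 > 0 \<and> d1 > 0 \<and> coprime n1 d1 \<and> n3 = n1 * d1 \<and>
                  class_with (order_of L) (of_nat n1 / of_nat d1) C \<longleftrightarrow>
                n1 = m1 div n2 \<and> d1 = m2 div n2)))"
  proof (intro allI impI)
    fix m1 m2 m3 n2 n3 n4 :: nat
    assume "m1 > 0 \<and> m2 > 0 \<and> m3 < gcd m1 m2 \<and>
       n2 = gcd m1 m2 \<and> n3 = m1 * m2 div n2\<^sup>2 \<and> n4 = m3"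
    then have m: "m1 > 0" "m2 > 0" "m3 < n2" and n: "n2 = gcd m1 m2" "n3 = m1 * m2 div n2\<^sup>2" "n4 = m3"
      by auto
    obtain n d where nd: "n > 0" "d > 0" "coprime n d" and m12: "m1 = n * n2" "m2 = d * n2"
      using gcd_cofactors[OF m(1,2)] unfolding n(1) by metis
    have n2: "n2 > 0" using m(3) by simp
    have n3: "n3 = n * d" unfolding n(2) m12 using n2 by (simp add: power2_eq_square)
    have div: "m1 div n2 = n" "m2 div n2 = d" unfolding m12 using n2 by simp_all
    let ?R = "rep_lattice m1 m2 m3" and ?\<Lambda> = "rep_lattice (n * d * n2) n2 m3"
    note cor = corresponds_rep_mat_iff[OF m(1,2), of _ m3]
    have "is_order ?\<Lambda>" "Lambda_a \<subseteq> ?\<Lambda>"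
      by (intro is_order_rep_lattice Lambda_a_subset_rep_lattice; use nd n2 in simp)+
    moreover have "is_Zbasis (avec \<cdot>\<^sub>t alpha_mat n2 n3 n4) ?\<Lambda>"
      unfolding n3 n(3) using nd n2 by (subst is_Zbasis_alpha_iff) auto
    moreover have "order_of L = ?\<Lambda>" if "L \<in> eps_rel `` {?R}" for L
      using order_of_eps_invariant[of ?R L] that order_of_rep_lattice[OF nd(1,2) n2 nd(3), of m3]
      unfolding m12 by auto
    moreover have "(n1 > 0 \<and> d1 > 0 \<and> coprime n1 d1 \<and> n3 = n1 * d1 \<and>
        class_with ?\<Lambda> (of_nat n1 / of_nat d1) (eps_rel `` {?R})) \<longleftrightarrow> n1 = n \<and> d1 = d" for n1 d1
    proof -
      have "class_with ?\<Lambda> (of_nat n / of_nat d) (eps_rel `` {?R})"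
        using class_with_iff[OF nd(1,2) n2 m(3) nd(3)] unfolding m12 by blast
      then show ?thesis using class_with_pair_unique[of ?\<Lambda> n d _ n1 d1] nd n3 by blast
    qed
    ultimately show "(\<exists>!C. corresponds C (rep_mat m1 m2 m3)) \<and>
       (\<forall>C. corresponds C (rep_mat m1 m2 m3) \<longrightarrow>
          (\<forall>L\<in>C. is_order (order_of L) \<and> Lambda_a \<subseteq> order_of L \<and>
             is_Zbasis (avec \<cdot>\<^sub>t alpha_mat n2 n3 n4) (order_of L) \<and>
             (\<forall>n1 d1. n1 > 0 \<and> d1 > 0 \<and> coprime n1 d1 \<and> n3 = n1 * d1 \<and>
                  class_with (order_of L) (of_nat n1 / of_nat d1) C \<longleftrightarrow>
                n1 = m1 div n2 \<and> d1 = m2 div n2)))"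
      unfolding cor div by simp
  qed
qed

end
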